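(* Let $W:\mathbb{R}\to\mathbb{R}$ be continuously differentiable and even, and let $c>0$ be such that $x\mapsto W(x)+\frac{c}{2}x^2$ is convex. Let $v_0:\mathbb{R}\to\mathbb{R}$ be absolutely continuous, let $m_1,\dots,m_N>0$ with $\sum_{i=1}^Nm_i=1$, let $x_1,\dots,x_N\in\mathbb{R}$, and let $\gamma_1,\dots,\gamma_N:[0,\infty)\to\mathbb{R}$ be sticky particle trajectories with masses $m_1,\dots,m_N$, initial positions $x_1,\dots,x_N$ and initial velocities $v_i=v_0(x_i)$. Let $i,j\in\{1,\dots,N\}$. (i) For $0<s\le t$, $$\frac{|\gamma_i(t)-\gamma_j(t)|}{\sinh(\sqrt{c}\,t)}\le\frac{|\gamma_i(s)-\gamma_j(s)|}{\sinh(\sqrt{c}\,s)} .$$ (ii) If $x_i\ge x_j$, then $$0\le\gamma_i(t)-\gamma_j(t)\le\cosh(\sqrt{c}\,t)(x_i-x_j)+\frac{1}{\sqrt{c}}\sinh(\sqrt{c}\,t)\int_{x_j}^{x_i}|v_0'(x)|\,dx$$ for all $t\ge0$.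
   Context: Sticky particle trajectories with masses $m_1,\dots,m_N>0$ ($\sum_i m_i=1$), initial positions $x_1,\dots,x_N$ and initial velocities $v_1,\dots,v_N$ are continuous, piecewise $C^2$ paths $\gamma_1,\dots,\gamma_N:[0,\infty)\to\mathbb{R}$ with the following properties: (a) for each $i$ and all but finitely many $t\in(0,\infty)$, $\ddot\gamma_i(t)=-\sum_{j=1}^Nm_jW'(\gamma_i(t)-\gamma_j(t))$; (b) $\gamma_i(0)=x_i$ and $\dot\gamma_i(0)=v_i$ (right derivative) for each $i$; (c) if $0\le s\le t$ and $\gamma_i(s)=\gamma_j(s)$, then $\gamma_i(t)=\gamma_j(t)$; (d) if $t>0$, $\{i_1,\dots,i_k\}\subset\{1,\dots,N\}$ and $\gamma_{i_1}(t)=\dots=\gamma_{i_k}(t)\ne\gamma_i(t)$ for all $i\notin\{i_1,\dots,i_k\}$, then $$\dot\gamma_{i_j}(t+)=\frac{m_{i_1}\dot\gamma_{i_1}(t-)+\dots+m_{i_k}\dot\gamma_{i_k}(t-)}{m_{i_1}+\dots+m_{i_k}},\qquad j=1,\dots,k.$$ Piecewise $C^2$ means that $[0,\infty)$ is a union of finitely many consecutive closed intervals on each of which the path is $C^2$ up to the endpoints; $\dot\gamma(t\pm)$ denote right/left limits of $\dot\gamma$ at $t$. Absolutely continuous on $\mathbb{R}$ means: for every $\epsilon>0$ there is $\delta>0$ such that $\sum_k|v_0(b_k)-v_0(a_k)|<\epsilon$ for every finite family of disjoint intervals $(a_k,b_k)\subset\mathbb{R}$ with $\sum_k(b_k-a_k)<\delta$.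 *)

theory Defs
  imports "HOL-Analysis.Analysis"
begin

(* Only meant for nondegenerate intervals I. Derivatives are taken within I, hence one-sided at
   the endpoints of I; continuity of f and g on I follows from their differentiability. *)
definition C2_on :: "(real \<Rightarrow> real) \<Rightarrow> real set \<Rightarrow> bool" where
  "C2_on f I \<longleftrightarrow>
     (\<exists>g h. (\<forall>t\<in>I. (f has_real_derivative g t) (at t within I)) \<and>
            (\<forall>t\<in>I. (g has_real_derivative h t) (at t within I)) \<and>
            continuous_on I h)"

(* Paths are total functions on the reals of which only the values on {0..} matter. The pieces
   are the intervals between consecutive breakpoints and the unbounded interval after the last. *)
definition piecewise_C2 :: "(real \<Rightarrow> real) \<Rightarrow> bool" where
  "piecewise_C2 f \<longleftrightarrow>
     (\<exists>(n::nat) \<tau>. \<tau> 0 = 0 \<and> (\<forall>k<n. \<tau> k < \<tau> (Suc k)) \<and>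
        (\<forall>k<n. C2_on f {\<tau> k..\<tau> (Suc k)}) \<and> C2_on f {\<tau> n..})"

(* The first conjunct rules out that the second one only concerns the unspecified values of
   deriv f at points where f is not differentiable. *)
definition has_second_deriv :: "(real \<Rightarrow> real) \<Rightarrow> real \<Rightarrow> real \<Rightarrow> bool" where
  "has_second_deriv f a t \<longleftrightarrow>
     (\<forall>\<^sub>F s in nhds t. f differentiable at s) \<and> (deriv f has_real_derivative a) (at t)"

(* For t > 0 and a piecewise C^2 path f both limits exist, and f is differentiable in the
   ordinary two-sided sense at all points close to t other than t. *)
definition left_velocity :: "(real \<Rightarrow> real) \<Rightarrow> real \<Rightarrow> real" where
  "left_velocity f t = Lim (at_left t) (deriv f)"

definition right_velocity :: "(real \<Rightarrow> real) \<Rightarrow> real \<Rightarrow> real" where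
  "right_velocity f t = Lim (at_right t) (deriv f)"

(* In the last conjunct, I ranges over the sets of all particles located at one common point
   at time t. *)
definition sticky_particle_trajectories ::
  "(real \<Rightarrow> real) \<Rightarrow> nat \<Rightarrow> (nat \<Rightarrow> real) \<Rightarrow> (nat \<Rightarrow> real) \<Rightarrow> (nat \<Rightarrow> real) \<Rightarrow> (nat \<Rightarrow> real \<Rightarrow> real) \<Rightarrow> bool"
  where
  "sticky_particle_trajectories W N m x v \<gamma> \<longleftrightarrow>
     (\<forall>i\<in>{1..N}. continuous_on {0..} (\<gamma> i) \<and> piecewise_C2 (\<gamma> i)) \<and>
     (\<forall>i\<in>{1..N}. finite {t. 0 < t \<and>
        \<not> has_second_deriv (\<gamma> i) (- (\<Sum>j=1..N. m j * deriv W (\<gamma> i t - \<gamma> j t))) t}) \<and>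
     (\<forall>i\<in>{1..N}. \<gamma> i 0 = x i \<and> (\<gamma> i has_real_derivative v i) (at 0 within {0..})) \<and>
     (\<forall>i\<in>{1..N}. \<forall>j\<in>{1..N}. \<forall>s t. 0 \<le> s \<and> s \<le> t \<and> \<gamma> i s = \<gamma> j s \<longrightarrow> \<gamma> i t = \<gamma> j t) \<and>
     (\<forall>t I. 0 < t \<and> I \<subseteq> {1..N} \<and> I \<noteq> {} \<and>
        (\<forall>i\<in>I. \<forall>j\<in>I. \<gamma> i t = \<gamma> j t) \<and>
        (\<forall>i\<in>I. \<forall>j\<in>{1..N} - I. \<gamma> i t \<noteq> \<gamma> j t) \<longrightarrow>
        (\<forall>j\<in>I. right_velocity (\<gamma> j) t =
           (\<Sum>i\<in>I. m i * left_velocity (\<gamma> i) t) / (\<Sum>i\<in>I. m i)))"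

(* HOL-Analysis has absolute continuity only as a relation between measures. *)
definition absolutely_continuous_fun :: "(real \<Rightarrow> real) \<Rightarrow> bool" where
  "absolutely_continuous_fun f \<longleftrightarrow>
     (\<forall>\<epsilon>>0. \<exists>\<delta>>0. \<forall>(n::nat) a b.
        (\<forall>k<n. a k < b k) \<and> disjoint_family_on (\<lambda>k. {a k<..<b k}) {..<n} \<and>
        (\<Sum>k<n. b k - a k) < \<delta> \<longrightarrow>
        (\<Sum>k<n. \<bar>f (b k) - f (a k)\<bar>) < \<epsilon>)"

end

theory Submission
  imports Defs
begin

text \<open>Fix two particles with \<open>x k \<ge> x l\<close> and let \<open>y = \<gamma> k - \<gamma> l\<close>. Trajectories that have met stay
together, so by the intermediate value theorem they never change order, and \<open>y \<ge> 0\<close>. Between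
collisions the semiconvexity of \<open>W\<close> gives \<open>y'' \<le> c y\<close>, because \<open>W' + c id\<close> is increasing and the
masses add up to 1. So for every solution \<open>f \<ge> 0\<close> of \<open>f'' = c f\<close> the Wronskian
\<open>z = y' f - y f'\<close> is nonincreasing between collisions (\<open>wronskian_antimono\<close>). If \<open>z \<le> B\<close> for a
constant \<open>B\<close>, then \<open>(y / f)' = z / f\<^sup>2 \<le> B / f\<^sup>2\<close>. The two claims are the cases
\<open>f = sinh (sqrt c t)\<close>, where \<open>z\<close> starts at a nonpositive value and \<open>B = 0\<close>, and
\<open>f = cosh (sqrt c t)\<close>, where \<open>z\<close> starts at \<open>v\<^sub>0 (x k) - v\<^sub>0 (x l)\<close> and \<open>B\<close> is the integral of
\<open>\<bar>v\<^sub>0'\<bar>\<close> between the two starting points.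

The difficulty is that a collision of particle \<open>k\<close> with some particle other than \<open>l\<close> may increase
\<open>y'\<close>, and with it \<open>z\<close>. But all members of a cluster arrive at the same place, and the ones that
started further to the left arrive with the larger velocities. Hence the average velocity with which
\<open>k\<close> leaves is at most the arrival velocity of the leftmost member \<open>d\<close> of its cluster, and
symmetrically for \<open>l\<close> and the rightmost member \<open>e\<close> of its cluster. So the Wronskian of \<open>(k, l)\<close>
after the collision is at most the Wronskian of \<open>(d, e)\<close> before it, where
\<open>x l \<le> x e \<le> x d \<le> x k\<close>. A bound \<open>B k l\<close> that shrinks when the pair is replaced by such an inner
pair is therefore propagated through all collisions; \<open>wronskian_le\<close> does this by induction on the
number of singular times already passed.

The initial bound \<open>v\<^sub>0 y - v\<^sub>0 x \<le> \<integral>\<bar>v\<^sub>0'\<bar>\<close> over \<open>[x, y]\<close> is Lebesgue's fundamental theorem of calculus for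
absolutely continuous functions, proved in the first part
(\<open>absolutely_continuous_fun_deriv\<close>): the function is a difference of two increasing absolutely
continuous functions, the Stieltjes measure of each has a density by the Radon-Nikodym theorem, and
an indefinite integral is differentiable almost everywhere with the density as derivative.\<close>

section \<open>Variation of absolutely continuous functions\<close>

text \<open>The projection of the line onto \<open>[x, y]\<close>. Precomposing with it turns a function on \<open>[x, y]\<close> into
one on the whole line that is constant outside, and cuts families of intervals down to \<open>[x, y]\<close>.\<close>
definition confine :: "real \<Rightarrow> real \<Rightarrow> real \<Rightarrow> real" where
  "confine x y t = max x (min y t)"

lemma confine_mono: "s \<le> t \<Longrightarrow> confine x y s \<le> confine x y t"
  by (auto simp: confine_def)

lemma disjoint_confine:
  assumes "disjoint_family_on (\<lambda>k. {a k<..<b k}) K"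
  shows "disjoint_family_on (\<lambda>k. {confine x y (a k)<..<confine x y (b k)}) K"
proof -
  have "{confine x y s<..<confine x y t} \<subseteq> {s<..<t}" for s t
    by (auto simp: confine_def max_def min_def split: if_splits)
  then show ?thesis
    using assms unfolding disjoint_family_on_def by blast
qed

lemma sum_disjoint_lengths_le:
  fixes a b :: "'i \<Rightarrow> real"
  assumes "finite K" "\<And>k. k \<in> K \<Longrightarrow> a k \<le> b k"
    and disj: "disjoint_family_on (\<lambda>k. {a k<..<b k}) K"
    and sub: "\<And>k. k \<in> K \<Longrightarrow> {a k<..<b k} \<subseteq> S"
    and S: "S \<in> sets lborel" "emeasure lborel S \<le> ennreal L" "0 \<le> L"
  shows "(\<Sum>k\<in>K. b k - a k) \<le> L"
proof -
  have "ennreal (\<Sum>k\<in>K. b k - a k) = (\<Sum>k\<in>K. emeasure lborel {a k<..<b k})"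
    using assms(2) by (subst sum_ennreal[symmetric]) auto
  also have "\<dots> = emeasure lborel (\<Union>k\<in>K. {a k<..<b k})"
    using assms by (intro sum_emeasure) auto
  also have "\<dots> \<le> emeasure lborel S"
    using sub S by (intro emeasure_mono) auto
  also have "\<dots> \<le> ennreal L" by fact
  finally show ?thesis
    using S(3) by (simp add: ennreal_le_iff)
qed

text \<open>The defining property speaks of families of nondegenerate intervals indexed by an initial segment
of the naturals. Confining a family produces empty intervals, and other index sets are convenient
below; degenerate intervals contribute nothing and the remaining ones can be enumerated.\<close>
lemma absolutely_continuous_fun_family:
  fixes f :: "real \<Rightarrow> real"
  assumes "absolutely_continuous_fun f" "\<epsilon> > 0"
  shows "\<exists>\<delta>>0. \<forall>(K::'i set) a b. finite K \<and> (\<forall>k\<in>K. a k \<le> b k) \<and>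
      disjoint_family_on (\<lambda>k. {a k<..<b k}) K \<and> (\<Sum>k\<in>K. b k - a k) < \<delta> \<longrightarrow>
      (\<Sum>k\<in>K. \<bar>f (b k) - f (a k)\<bar>) < \<epsilon>"
proof -
  have "\<exists>\<delta>>0. \<forall>(n::nat) a b. (\<forall>k<n. a k < b k) \<and>
      disjoint_family_on (\<lambda>k. {a k<..<b k}) {..<n} \<and> (\<Sum>k<n. b k - a k) < \<delta> \<longrightarrow>
      (\<Sum>k<n. \<bar>f (b k) - f (a k)\<bar>) < \<epsilon>"
    using assms(1)[unfolded absolutely_continuous_fun_def, rule_format, OF assms(2)] .
  then obtain \<delta> where \<delta>: "\<delta> > 0" and ac: "\<And>(n::nat) a b. \<lbrakk>\<forall>k<n. a k < b k;
        disjoint_family_on (\<lambda>k. {a k<..<b k}) {..<n}; (\<Sum>k<n. b k - a k) < \<delta>\<rbrakk>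
      \<Longrightarrow> (\<Sum>k<n. \<bar>f (b k) - f (a k)\<bar>) < \<epsilon>"
    by (elim exE conjE) (simp only: conj_imp_eq_imp_imp)
  show ?thesis
  proof (rule exI[of _ \<delta>], intro conjI allI impI \<delta>)
    fix K :: "'i set" and a b :: "'i \<Rightarrow> real"
    assume *: "finite K \<and> (\<forall>k\<in>K. a k \<le> b k) \<and>
      disjoint_family_on (\<lambda>k. {a k<..<b k}) K \<and> (\<Sum>k\<in>K. b k - a k) < \<delta>"
    then have K: "finite K" and ab: "\<And>k. k \<in> K \<Longrightarrow> a k \<le> b k"
      and disj: "disjoint_family_on (\<lambda>k. {a k<..<b k}) K" and len: "(\<Sum>k\<in>K. b k - a k) < \<delta>"
      by auto
    define K' where "K' = {k \<in> K. a k < b k}"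
    have K': "finite K'" "K' \<subseteq> K" using K by (auto simp: K'_def)
    obtain h where h: "bij_betw h {..<card K'} K'"
      using ex_bij_betw_nat_finite[OF K'(1)] by (auto simp: atLeast0LessThan)
    have reduce: "(\<Sum>k\<in>K. g (a k) (b k)) = (\<Sum>l<card K'. g (a (h l)) (b (h l)))"
      if "\<And>t. g t t = (0::real)" for g
    proof -
      have "(\<Sum>k\<in>K. g (a k) (b k)) = (\<Sum>k\<in>K'. g (a k) (b k))"
        using K ab that by (intro sum.mono_neutral_right) (force simp: K'_def)+
      then show ?thesis
        using sum.reindex_bij_betw[OF h, of "\<lambda>k. g (a k) (b k)"] by simp
    qed
    have "(\<Sum>l<card K'. \<bar>f (b (h l)) - f (a (h l))\<bar>) < \<epsilon>"
    proof (rule ac)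
      show "\<forall>l<card K'. a (h l) < b (h l)"
        using bij_betwE[OF h] by (auto simp: K'_def)
      show "disjoint_family_on (\<lambda>l. {a (h l)<..<b (h l)}) {..<card K'}"
        using disj h K'(2) unfolding disjoint_family_on_def bij_betw_def inj_on_def by blast
      show "(\<Sum>l<card K'. b (h l) - a (h l)) < \<delta>"
        using len reduce[of "\<lambda>s t. t - s"] by simp
    qed
    then show "(\<Sum>k\<in>K. \<bar>f (b k) - f (a k)\<bar>) < \<epsilon>"
      using reduce[of "\<lambda>s t. \<bar>f t - f s\<bar>"] by simp
  qed
qed

lemma absolutely_continuous_fun_confine:
  assumes "absolutely_continuous_fun f"
  shows "absolutely_continuous_fun (\<lambda>t. f (confine x y t))"
  unfolding absolutely_continuous_fun_def
proof (intro allI impI)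
  fix \<epsilon> :: real assume "\<epsilon> > 0"
  obtain \<delta> where \<delta>: "\<delta> > 0" and ac: "\<forall>(K::nat set) a b. finite K \<and> (\<forall>k\<in>K. a k \<le> b k) \<and>
        disjoint_family_on (\<lambda>k. {a k<..<b k}) K \<and> (\<Sum>k\<in>K. b k - a k) < \<delta> \<longrightarrow>
      (\<Sum>k\<in>K. \<bar>f (b k) - f (a k)\<bar>) < \<epsilon>"
    using absolutely_continuous_fun_family[OF assms \<open>\<epsilon> > 0\<close>] by (elim exE conjE)
  have "(\<Sum>k<n. \<bar>f (confine x y (b k)) - f (confine x y (a k))\<bar>) < \<epsilon>"
    if ab: "\<forall>k<n. a k < b k" and disj: "disjoint_family_on (\<lambda>k. {a k<..<b k}) {..<n}"
      and len: "(\<Sum>k<n. b k - a k) < \<delta>" for n :: nat and a b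
  proof (rule ac[rule_format], intro conjI ballI)
    have "(\<Sum>k<n. confine x y (b k) - confine x y (a k)) \<le> (\<Sum>k<n. b k - a k)"
    proof (rule sum_mono)
      fix k assume "k \<in> {..<n}"
      then have "a k < b k" using ab by auto
      then show "confine x y (b k) - confine x y (a k) \<le> b k - a k"
        by (auto simp: confine_def)
    qed
    then show "(\<Sum>k<n. confine x y (b k) - confine x y (a k)) < \<delta>"
      using len by simp
  qed (use ab disj in \<open>auto intro!: confine_mono disjoint_confine simp: less_imp_le\<close>)
  then show "\<exists>\<delta>>0. \<forall>(n::nat) a b. (\<forall>k<n. a k < b k) \<and>
      disjoint_family_on (\<lambda>k. {a k<..<b k}) {..<n} \<and> (\<Sum>k<n. b k - a k) < \<delta> \<longrightarrow>
      (\<Sum>k<n. \<bar>f (confine x y (b k)) - f (confine x y (a k))\<bar>) < \<epsilon>"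
    using \<delta> by blast
qed

lemma absolutely_continuous_fun_diff:
  assumes f: "absolutely_continuous_fun f" and g: "absolutely_continuous_fun g"
  shows "absolutely_continuous_fun (\<lambda>t. f t - g t)"
  unfolding absolutely_continuous_fun_def
proof (intro allI impI)
  fix \<epsilon> :: real assume "\<epsilon> > 0"
  then have e: "\<epsilon> / 2 > 0" by simp
  obtain d1 where d1: "d1 > 0" "\<And>(n::nat) a b. (\<forall>k<n. a k < b k) \<and>
      disjoint_family_on (\<lambda>k. {a k<..<b k}) {..<n} \<and> (\<Sum>k<n. b k - a k) < d1 \<longrightarrow>
      (\<Sum>k<n. \<bar>f (b k) - f (a k)\<bar>) < \<epsilon> / 2"
    using f[unfolded absolutely_continuous_fun_def, rule_format, OF e] by (elim exE conjE) blast
  obtain d2 where d2: "d2 > 0" "\<And>(n::nat) a b. (\<forall>k<n. a k < b k) \<and>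
      disjoint_family_on (\<lambda>k. {a k<..<b k}) {..<n} \<and> (\<Sum>k<n. b k - a k) < d2 \<longrightarrow>
      (\<Sum>k<n. \<bar>g (b k) - g (a k)\<bar>) < \<epsilon> / 2"
    using g[unfolded absolutely_continuous_fun_def, rule_format, OF e] by (elim exE conjE) blast
  show "\<exists>\<delta>>0. \<forall>(n::nat) a b. (\<forall>k<n. a k < b k) \<and>
      disjoint_family_on (\<lambda>k. {a k<..<b k}) {..<n} \<and> (\<Sum>k<n. b k - a k) < \<delta> \<longrightarrow>
      (\<Sum>k<n. \<bar>(f (b k) - g (b k)) - (f (a k) - g (a k))\<bar>) < \<epsilon>"
  proof (rule exI[of _ "min d1 d2"], intro conjI allI impI, use d1(1) d2(1) in simp)
    fix n :: nat and a b assume *: "(\<forall>k<n. a k < b k) \<and>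
      disjoint_family_on (\<lambda>k. {a k<..<b k}) {..<n} \<and> (\<Sum>k<n. b k - a k) < min d1 d2"
    have "(\<Sum>k<n. \<bar>(f (b k) - g (b k)) - (f (a k) - g (a k))\<bar>)
        \<le> (\<Sum>k<n. \<bar>f (b k) - f (a k)\<bar> + \<bar>g (b k) - g (a k)\<bar>)"
      by (intro sum_mono) linarith
    also have "\<dots> < \<epsilon>"
      using d1(2)[of n a b] d2(2)[of n a b] * by (simp add: sum.distrib)
    finally show "(\<Sum>k<n. \<bar>(f (b k) - g (b k)) - (f (a k) - g (a k))\<bar>) < \<epsilon>" .
  qed
qed

text \<open>Finite families of disjoint intervals on the whole line, given by their number and the functions of
left and right endpoints. Unlike partitions of an interval they do not depend on the interval, which
is cut out later by \<open>confine\<close>; so one family serves \<open>[x, y]\<close>, \<open>[y, z]\<close> and \<open>[x, z]\<close> at once.\<close>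
definition interval_families :: "(nat \<times> (nat \<Rightarrow> real) \<times> (nat \<Rightarrow> real)) set" where
  "interval_families = {(n, p, q). (\<forall>k<n. p k \<le> q k) \<and> disjoint_family_on (\<lambda>k. {p k<..<q k}) {..<n}}"

definition jump_sum :: "(real \<Rightarrow> real) \<Rightarrow> real \<Rightarrow> real \<Rightarrow> nat \<times> (nat \<Rightarrow> real) \<times> (nat \<Rightarrow> real) \<Rightarrow> real"
  where "jump_sum f x y = (\<lambda>(n, p, q). \<Sum>k<n. \<bar>f (confine x y (q k)) - f (confine x y (p k))\<bar>)"

definition variation :: "(real \<Rightarrow> real) \<Rightarrow> real \<Rightarrow> real \<Rightarrow> real" where
  "variation f x y = (SUP F\<in>interval_families. jump_sum f x y F)"

lemma interval_families_nonempty: "interval_families \<noteq> {}"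
proof -
  have "(0, \<lambda>_. 0, \<lambda>_. 0) \<in> interval_families" by (simp add: interval_families_def disjoint_family_on_def)
  then show ?thesis by blast
qed

text \<open>Confining to \<open>[x, z]\<close> splits additively into confining to \<open>[x, y]\<close> and to \<open>[y, z]\<close>, so an
interval that straddles \<open>y\<close> is handled by the triangle inequality alone.\<close>
lemma jump_sum_split:
  assumes "x \<le> y" "y \<le> z"
  shows "jump_sum f x z F \<le> jump_sum f x y F + jump_sum f y z F"
proof -
  have split: "f (confine x z t) = f (confine x y t) + f (confine y z t) - f y" for t
    using assms by (auto simp: confine_def max_def min_def)
  show ?thesis
    unfolding jump_sum_def
    by (cases F) (auto simp: split sum.distrib[symmetric] intro!: sum_mono)
qed

text \<open>On an interval shorter than the \<open>\<delta>\<close> that belongs to \<open>\<epsilon> = 1\<close> every jump sum is at most 1, and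
\<open>[x, y]\<close> is a union of finitely many such intervals.\<close>
lemma jump_sum_bounded:
  assumes f: "absolutely_continuous_fun f" and "x \<le> y"
  shows "bdd_above (jump_sum f x y ` interval_families)"
proof -
  obtain \<delta> where \<delta>: "\<delta> > 0" and ac: "\<forall>(K::nat set) a b. finite K \<and> (\<forall>k\<in>K. a k \<le> b k) \<and>
        disjoint_family_on (\<lambda>k. {a k<..<b k}) K \<and> (\<Sum>k\<in>K. b k - a k) < \<delta> \<longrightarrow>
      (\<Sum>k\<in>K. \<bar>f (b k) - f (a k)\<bar>) < 1"
    using absolutely_continuous_fun_family[OF f zero_less_one] by (elim exE conjE)
  have short: "jump_sum f u v F \<le> 1"
    if F: "F \<in> interval_families" and uv: "u \<le> v" "v - u < \<delta>" for F u v
  proof -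
    obtain n p q where Fe: "F = (n, p, q)" by (cases F)
    have pq: "\<forall>k<n. p k \<le> q k" "disjoint_family_on (\<lambda>k. {p k<..<q k}) {..<n}"
      using F by (auto simp: Fe interval_families_def)
    have "(\<Sum>k<n. confine u v (q k) - confine u v (p k)) \<le> v - u"
    proof (rule sum_disjoint_lengths_le[where S = "{u..v}"])
      show "disjoint_family_on (\<lambda>k. {confine u v (p k)<..<confine u v (q k)}) {..<n}"
        by (rule disjoint_confine) fact
      show "{confine u v (p k)<..<confine u v (q k)} \<subseteq> {u..v}" for k
        using uv by (auto simp: confine_def)
    qed (use pq uv in \<open>auto intro!: confine_mono\<close>)
    then have "(\<Sum>k<n. \<bar>f (confine u v (q k)) - f (confine u v (p k))\<bar>) < 1"
      using pq uv by (intro ac[rule_format]) (auto intro!: confine_mono disjoint_confine)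
    then show ?thesis by (simp add: Fe jump_sum_def)
  qed
  obtain J :: nat where J: "(y - x) / \<delta> < real J" using reals_Archimedean2 by blast
  have Jpos: "real J > 0" using J \<open>x \<le> y\<close> \<delta>
    by (meson divide_nonneg_pos diff_ge_0_iff_ge le_less_trans)
  define h where "h = (y - x) / real J"
  have h: "0 \<le> h" "h < \<delta>" "x + real J * h = y"
    using J Jpos \<delta> \<open>x \<le> y\<close> by (auto simp: h_def field_simps)
  have "jump_sum f x (x + real l * h) F \<le> 1 + real l" if F: "F \<in> interval_families" for F l
  proof (induction l)
    case 0
    show ?case using short[OF F, of x x] \<delta> by simp
  next
    case (Suc l)
    have "jump_sum f x (x + real (Suc l) * h) F
        \<le> jump_sum f x (x + real l * h) F + jump_sum f (x + real l * h) (x + real (Suc l) * h) F"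
      using h by (intro jump_sum_split) (auto simp: algebra_simps)
    also have "jump_sum f (x + real l * h) (x + real (Suc l) * h) F \<le> 1"
      using h by (intro short[OF F]) (auto simp: algebra_simps)
    finally show ?case using Suc by simp
  qed
  from this[of _ J] show ?thesis
    unfolding h(3) by (auto simp: bdd_above_def intro!: exI[of _ "1 + real J"])
qed

lemma jump_sum_le_variation:
  assumes "absolutely_continuous_fun f" "x \<le> y" "F \<in> interval_families"
  shows "jump_sum f x y F \<le> variation f x y"
  unfolding variation_def
  using assms jump_sum_bounded by (intro cSUP_upper) auto

lemma variation_split:
  assumes "absolutely_continuous_fun f" "x \<le> y" "y \<le> z"
  shows "variation f x z \<le> variation f x y + variation f y z"
  unfolding variation_def[of f x z]
proof (rule cSUP_least[OF interval_families_nonempty])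
  fix F assume "F \<in> interval_families"
  then show "jump_sum f x z F \<le> variation f x y + variation f y z"
    using jump_sum_split[of x y z f F] jump_sum_le_variation[of f x y F]
      jump_sum_le_variation[of f y z F] assms by linarith
qed

text \<open>A family for \<open>[x, y]\<close> can be extended by the single interval \<open>(y, z)\<close>. In particular both the
variation and the variation minus \<open>f\<close> are increasing.\<close>
lemma variation_increment:
  assumes f: "absolutely_continuous_fun f" and xyz: "x \<le> y" "y \<le> z"
  shows "variation f x y + \<bar>f z - f y\<bar> \<le> variation f x z"
proof -
  have "jump_sum f x y F \<le> variation f x z - \<bar>f z - f y\<bar>" if F: "F \<in> interval_families" for F
  proof -
    obtain n p q where Fe: "F = (n, p, q)" by (cases F)
    have pq: "\<forall>k<n. p k \<le> q k" "disjoint_family_on (\<lambda>k. {p k<..<q k}) {..<n}"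
      using F by (auto simp: Fe interval_families_def)
    define p' where "p' = (\<lambda>k. if k < n then confine x y (p k) else y)"
    define q' where "q' = (\<lambda>k. if k < n then confine x y (q k) else z)"
    have "disjoint_family_on (\<lambda>k. {p' k<..<q' k}) {..<Suc n}"
    proof -
      have "disjoint_family_on (\<lambda>k. {p' k<..<q' k}) {..<n}"
        using disjoint_confine[OF pq(2), of x y] by (simp add: p'_def q'_def disjoint_family_on_def)
      moreover have "{p' n<..<q' n} \<inter> (\<Union>k\<in>{..<n}. {p' k<..<q' k}) = {}"
        using xyz by (auto simp: p'_def q'_def confine_def)
      ultimately show ?thesis
        by (subst lessThan_Suc, subst disjoint_family_on_insert) (auto simp: Int_commute)
    qed
    then have "(Suc n, p', q') \<in> interval_families"
      using pq xyz by (auto simp: interval_families_def p'_def q'_def intro!: confine_mono)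
    then have "jump_sum f x z (Suc n, p', q') \<le> variation f x z"
      using xyz by (intro jump_sum_le_variation f) auto
    moreover have "confine x z (confine x y t) = confine x y t" for t
      using xyz by (auto simp: confine_def)
    then have "jump_sum f x z (Suc n, p', q') = jump_sum f x y F + \<bar>f z - f y\<bar>"
      using xyz by (simp add: jump_sum_def Fe p'_def q'_def) (simp add: confine_def)
    ultimately show ?thesis by linarith
  qed
  then have "variation f x y \<le> variation f x z - \<bar>f z - f y\<bar>"
    unfolding variation_def[of f x y] by (intro cSUP_least interval_families_nonempty)
  then show ?thesis by simp
qed

text \<open>Choose for each of the given short intervals a family that almost attains the variation on it. All
these families together form one disjoint family whose total length is still below \<open>\<delta>\<close>, so its jump
sum is small by the absolute continuity of \<open>f\<close>.\<close>
lemma absolutely_continuous_variation: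
  assumes f: "absolutely_continuous_fun f" and \<open>x \<le> y\<close>
  shows "absolutely_continuous_fun (\<lambda>t. variation f x (confine x y t))"
  unfolding absolutely_continuous_fun_def
proof (intro allI impI)
  fix \<epsilon> :: real assume \<epsilon>: "\<epsilon> > 0"
  obtain \<delta> where \<delta>: "\<delta> > 0" and ac: "\<forall>(K::(nat \<times> nat) set) a b. finite K \<and> (\<forall>k\<in>K. a k \<le> b k) \<and>
        disjoint_family_on (\<lambda>k. {a k<..<b k}) K \<and> (\<Sum>k\<in>K. b k - a k) < \<delta> \<longrightarrow>
      (\<Sum>k\<in>K. \<bar>f (b k) - f (a k)\<bar>) < \<epsilon> / 2"
    using absolutely_continuous_fun_family[OF f half_gt_zero[OF \<epsilon>]] by (elim exE conjE)
  have "(\<Sum>k<n. \<bar>variation f x (confine x y (b k)) - variation f x (confine x y (a k))\<bar>) < \<epsilon>"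
    if ab: "\<forall>k<n. a k < b k" and disj: "disjoint_family_on (\<lambda>k. {a k<..<b k}) {..<n}"
      and len: "(\<Sum>k<n. b k - a k) < \<delta>" for n :: nat and a b
  proof -
    define u where "u k = confine x y (a k)" for k
    define v where "v k = confine x y (b k)" for k
    have uv: "x \<le> u k" "u k \<le> v k" "v k - u k \<le> b k - a k" if "k < n" for k
      using ab that by (auto simp: u_def v_def confine_def less_imp_le)
    have disj_uv: "disjoint_family_on (\<lambda>k. {u k<..<v k}) {..<n}"
      unfolding u_def v_def by (rule disjoint_confine) fact
    \<comment> \<open>The error allowed in each of the \<open>n\<close> suprema; the summand 1 covers \<open>n = 0\<close>.\<close>
    define \<eta> where "\<eta> = \<epsilon> / (2 * (1 + real n))"
    have \<eta>: "\<eta> > 0" "real n * \<eta> \<le> \<epsilon> / 2" using \<epsilon> by (auto simp: \<eta>_def field_simps)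
    have "\<exists>F\<in>interval_families. variation f (u k) (v k) - \<eta> < jump_sum f (u k) (v k) F"
      if "k < n" for k
    proof -
      have "bdd_above (jump_sum f (u k) (v k) ` interval_families)"
        by (rule jump_sum_bounded) (use f uv that in auto)
      moreover have "variation f (u k) (v k) - \<eta> < (SUP F\<in>interval_families. jump_sum f (u k) (v k) F)"
        using \<eta> by (simp add: variation_def)
      ultimately show ?thesis
        using less_cSUP_iff[OF interval_families_nonempty] by blast
    qed
    then obtain F' where F': "\<And>k. k < n \<Longrightarrow> F' k \<in> interval_families \<and>
        variation f (u k) (v k) - \<eta> < jump_sum f (u k) (v k) (F' k)" by metis
    define N where "N k = fst (F' k)" for k
    define p where "p k = fst (snd (F' k))" for k
    define q where "q k = snd (snd (F' k))" for k
    have F: "(N k, p k, q k) \<in> interval_families"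
      and near: "variation f (u k) (v k) - \<eta> < jump_sum f (u k) (v k) (N k, p k, q k)" if "k < n" for k
      using F'[OF that] by (auto simp: N_def p_def q_def)
    define K where "K = Sigma {..<n} (\<lambda>k. {..<N k})"
    define P where "P = (\<lambda>(k, l). confine (u k) (v k) (p k l))"
    define Q where "Q = (\<lambda>(k, l). confine (u k) (v k) (q k l))"
    have sub: "{P (k, l)<..<Q (k, l)} \<subseteq> {u k<..<v k}" if "k < n" for k l
      using uv[OF that] by (auto simp: P_def Q_def confine_def)
    have disj_in: "disjoint_family_on (\<lambda>l. {P (k, l)<..<Q (k, l)}) {..<N k}" if "k < n" for k
      using F[OF that] by (auto simp: P_def Q_def interval_families_def intro!: disjoint_confine)
    have PQ: "P r \<le> Q r" if "r \<in> K" for r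
      using that F by (auto simp: K_def P_def Q_def interval_families_def intro!: confine_mono)
    have disjK: "disjoint_family_on (\<lambda>r. {P r<..<Q r}) K"
      unfolding disjoint_family_on_def
    proof (intro ballI impI)
      fix r r' assume r: "r \<in> K" "r' \<in> K" "r \<noteq> r'"
      obtain k l k' l' where kl: "r = (k, l)" "r' = (k', l')" by (cases r, cases r')
      show "{P r<..<Q r} \<inter> {P r'<..<Q r'} = {}"
      proof (cases "k = k'")
        case True
        then show ?thesis
          using r disj_in[of k] kl unfolding disjoint_family_on_def K_def by auto
      next
        case False
        then have "{u k<..<v k} \<inter> {u k'<..<v k'} = {}"
          using r kl disj_uv unfolding disjoint_family_on_def K_def by auto
        then show ?thesis
          using r kl sub[of k l] sub[of k' l'] unfolding K_def by blast
      qed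
    qed
    have sumK: "(\<Sum>r\<in>K. g r) = (\<Sum>k<n. \<Sum>l<N k. g (k, l))" for g :: "_ \<Rightarrow> real"
      unfolding K_def by (subst sum.Sigma) auto
    have "(\<Sum>r\<in>K. Q r - P r) = (\<Sum>k<n. \<Sum>l<N k. Q (k, l) - P (k, l))" by (rule sumK)
    also have "\<dots> \<le> (\<Sum>k<n. v k - u k)"
    proof (rule sum_mono)
      fix k assume "k \<in> {..<n}"
      then have k: "k < n" by simp
      show "(\<Sum>l<N k. Q (k, l) - P (k, l)) \<le> v k - u k"
        by (rule sum_disjoint_lengths_le[where S = "{u k<..<v k}"])
          (use sub[OF k] uv[OF k] disj_in[OF k] PQ k in \<open>auto simp: K_def\<close>)
    qed
    also have "\<dots> \<le> (\<Sum>k<n. b k - a k)" using uv by (intro sum_mono) auto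
    finally have "(\<Sum>r\<in>K. \<bar>f (Q r) - f (P r)\<bar>) < \<epsilon> / 2"
      using len disjK PQ by (intro ac[rule_format]) (auto simp: K_def)
    moreover have "(\<Sum>k<n. \<bar>variation f x (v k) - variation f x (u k)\<bar>)
        \<le> (\<Sum>k<n. jump_sum f (u k) (v k) (N k, p k, q k) + \<eta>)"
    proof (rule sum_mono)
      fix k assume "k \<in> {..<n}"
      then have k: "k < n" by simp
      show "\<bar>variation f x (v k) - variation f x (u k)\<bar>
          \<le> jump_sum f (u k) (v k) (N k, p k, q k) + \<eta>"
        using variation_increment[OF f uv(1,2)[OF k]] variation_split[OF f uv(1,2)[OF k]] near[OF k]
        by linarith
    qed
    moreover have "(\<Sum>k<n. jump_sum f (u k) (v k) (N k, p k, q k) + \<eta>)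
        = (\<Sum>r\<in>K. \<bar>f (Q r) - f (P r)\<bar>) + real n * \<eta>"
      by (simp add: sumK sum.distrib jump_sum_def P_def Q_def)
    ultimately show ?thesis using \<eta>(2) unfolding u_def v_def by linarith
  qed
  then show "\<exists>\<delta>>0. \<forall>(n::nat) a b. (\<forall>k<n. a k < b k) \<and>
      disjoint_family_on (\<lambda>k. {a k<..<b k}) {..<n} \<and> (\<Sum>k<n. b k - a k) < \<delta> \<longrightarrow>
      (\<Sum>k<n. \<bar>variation f x (confine x y (b k)) - variation f x (confine x y (a k))\<bar>) < \<epsilon>"
    using \<delta> by blast
qed

section \<open>Increasing absolutely continuous functions as indefinite integrals\<close>

lemma absolutely_continuous_fun_imp_continuous:
  assumes "absolutely_continuous_fun f"
  shows "continuous_on UNIV f"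
proof (clarsimp simp: continuous_on_iff)
  fix x \<epsilon> :: real assume "\<epsilon> > 0"
  obtain \<delta> where \<delta>: "\<delta> > 0" and ac: "\<forall>(K::unit set) a b. finite K \<and> (\<forall>k\<in>K. a k \<le> b k) \<and>
        disjoint_family_on (\<lambda>k. {a k<..<b k}) K \<and> (\<Sum>k\<in>K. b k - a k) < \<delta> \<longrightarrow>
      (\<Sum>k\<in>K. \<bar>f (b k) - f (a k)\<bar>) < \<epsilon>"
    using absolutely_continuous_fun_family[OF assms \<open>\<epsilon> > 0\<close>] by (elim exE conjE)
  have *: "\<bar>f t - f s\<bar> < \<epsilon>" if "s \<le> t" "t - s < \<delta>" for s t
    using ac[rule_format, of UNIV "\<lambda>_. s" "\<lambda>_. t"] that by (simp add: disjoint_family_on_def)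
  have "\<bar>f t - f x\<bar> < \<epsilon>" if "\<bar>t - x\<bar> < \<delta>" for t
    using *[of t x] *[of x t] that by (cases "t \<le> x") auto
  then show "\<exists>d>0. \<forall>x'. dist x' x < d \<longrightarrow> dist (f x') (f x) < \<epsilon>"
    using \<delta> by (auto simp: dist_real_def)
qed

lemma finite_interval_measure:
  assumes mono: "\<And>s t. s \<le> t \<Longrightarrow> F s \<le> F t" and cont: "continuous_on UNIV F"
    and const: "\<And>t. F (confine x y t) = F t" and "x \<le> y"
  shows "emeasure (interval_measure F) UNIV \<noteq> \<infinity>"
proof -
  have rcont: "continuous (at_right t) F" for t
    using cont by (meson UNIV_I continuous_on_eq_continuous_within continuous_within_subset subset_UNIV)
  have "emeasure (interval_measure F) UNIV = emeasure (interval_measure F) (\<Union>n::nat. {- real n<..real n})"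
  proof -
    have "\<exists>n::nat. t \<in> {- real n<..real n}" for t :: real
      using reals_Archimedean2[of "\<bar>t\<bar>"] by (auto simp: abs_less_iff less_imp_le) (metis less_eq_real_def minus_less_iff)
    then have "(\<Union>n::nat. {- real n<..real n}) = UNIV" by blast
    then show ?thesis by simp
  qed
  also have "\<dots> = (SUP n::nat. emeasure (interval_measure F) {- real n<..real n})"
    by (rule SUP_emeasure_incseq[symmetric]) (auto simp: incseq_def)
  also have "\<dots> \<le> ennreal (F y - F x)"
  proof (rule SUP_least)
    fix n :: nat
    have bounds: "F x \<le> F t" "F t \<le> F y" for t
      using mono[of x "confine x y t"] mono[of "confine x y t" y] const[of t] \<open>x \<le> y\<close>
      by (auto simp: confine_def)
    have "emeasure (interval_measure F) {- real n<..real n} = ennreal (F (real n) - F (- real n))"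
      by (rule emeasure_interval_measure_Ioc) (auto intro: mono rcont)
    also have "\<dots> \<le> ennreal (F y - F x)"
      using bounds[of "real n"] bounds[of "- real n"] by (intro ennreal_leI) linarith
    finally show "emeasure (interval_measure F) {- real n<..real n} \<le> ennreal (F y - F x)" .
  qed
  finally show ?thesis by (metis ennreal_less_top infinity_ennreal_def leD)
qed

text \<open>By inner regularity it is enough to bound the Stieltjes measure of a compact null set. Such a set has
an open neighbourhood of length below \<open>\<delta>\<close>, and if \<open>h\<close> is small enough, the cells of the grid of
width \<open>h\<close> that meet the set lie in this neighbourhood. The increments of \<open>F\<close> over these finitely
many cells add up to less than \<open>\<epsilon>\<close>.\<close>
lemma interval_measure_absolutely_continuous:
  assumes mono: "\<And>s t. s \<le> t \<Longrightarrow> F s \<le> F t" and F: "absolutely_continuous_fun F"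
    and const: "\<And>t. F (confine x y t) = F t" and "x \<le> y"
  shows "absolutely_continuous lborel (interval_measure F)"
  unfolding absolutely_continuous_def
proof
  fix N :: "real set" assume "N \<in> null_sets lborel"
  then have N: "N \<in> sets borel" "emeasure lborel N = 0" by auto
  let ?\<mu> = "interval_measure F"
  have cont: "continuous_on UNIV F" by (rule absolutely_continuous_fun_imp_continuous) fact
  have rcont: "continuous (at_right t) F" for t
    using cont by (meson UNIV_I continuous_on_eq_continuous_within continuous_within_subset subset_UNIV)
  have "emeasure ?\<mu> K = 0" if K: "K \<subseteq> N" "compact K" for K
  proof -
    have "emeasure ?\<mu> K \<le> 0 + ennreal \<epsilon>" if \<epsilon>: "\<epsilon> > 0" for \<epsilon> :: real
    proof -
      obtain \<delta> where \<delta>: "\<delta> > 0" and ac: "\<forall>(K::int set) a b. finite K \<and> (\<forall>k\<in>K. a k \<le> b k) \<and>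
            disjoint_family_on (\<lambda>k. {a k<..<b k}) K \<and> (\<Sum>k\<in>K. b k - a k) < \<delta> \<longrightarrow>
          (\<Sum>k\<in>K. \<bar>F (b k) - F (a k)\<bar>) < \<epsilon>"
        using absolutely_continuous_fun_family[OF F \<epsilon>] by (elim exE conjE)
      have Kb: "K \<in> sets borel" using K(2) by (intro borel_closed compact_imp_closed)
      have "ennreal (\<delta> / 2) > 0" using \<delta> by simp
      then obtain U where U: "open U" "K \<subseteq> U" "emeasure lborel (U - K) < ennreal (\<delta> / 2)"
        using outer_regular_lborel[OF Kb, of "\<delta> / 2"] \<delta> by auto
      have "emeasure lborel K = 0"
        using emeasure_mono[OF K(1), of lborel] N by auto
      then have lenU: "emeasure lborel U \<le> ennreal (\<delta> / 2)"
        using U(2,3) emeasure_subadditive[of K lborel "U - K"] U(1) Kb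
        by (auto simp: Un_absorb1 dest: less_imp_le)
      obtain e where e: "e > 0" "(\<Union>p\<in>K. ball p e) \<subseteq> U"
        using compact_subset_open_imp_ball_epsilon_subset[OF K(2) U(1,2)] by blast
      define h where "h = e / 2"
      have h: "h > 0" "h < e" using e by (auto simp: h_def)
      \<comment> \<open>The grid cell that contains \<open>p\<close>; cells are open on the left and closed on the right.\<close>
      define idx where "idx p = \<lceil>p / h\<rceil> - 1" for p
      have idx: "real_of_int (idx p) * h < p" "p \<le> (real_of_int (idx p) + 1) * h" for p
      proof -
        have "real_of_int \<lceil>p / h\<rceil> - 1 < p / h" by linarith
        then show "real_of_int (idx p) * h < p"
          using h(1) by (auto simp: idx_def pos_less_divide_eq)
        show "p \<le> (real_of_int (idx p) + 1) * h"
          using pos_divide_le_eq[OF h(1), of p "real_of_int \<lceil>p / h\<rceil>"] by (simp add: idx_def)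
      qed
      define S where "S = idx ` K"
      obtain M where M: "\<And>p. p \<in> K \<Longrightarrow> \<bar>p\<bar> \<le> M"
        using compact_imp_bounded[OF K(2)] by (auto simp: bounded_iff)
      have "S \<subseteq> {\<lceil>- M / h\<rceil> - 1..\<lceil>M / h\<rceil> - 1}"
      proof
        fix k assume "k \<in> S"
        then obtain p where p: "p \<in> K" "k = idx p" by (auto simp: S_def)
        then have "- M / h \<le> p / h" "p / h \<le> M / h"
          using M[OF p(1)] h(1) divide_right_mono[of "- M" p h] divide_right_mono[of p M h] by auto
        then show "k \<in> {\<lceil>- M / h\<rceil> - 1..\<lceil>M / h\<rceil> - 1}"
          using p ceiling_mono[of "- M / h" "p / h"] ceiling_mono[of "p / h" "M / h"] by (auto simp: idx_def)
      qed
      then have finS: "finite S" by (rule finite_subset) auto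
      have sub: "{real_of_int k * h<..<(real_of_int k + 1) * h} \<subseteq> U" if "k \<in> S" for k
      proof
        fix r assume r: "r \<in> {real_of_int k * h<..<(real_of_int k + 1) * h}"
        obtain p where p: "p \<in> K" "k = idx p" using \<open>k \<in> S\<close> by (auto simp: S_def)
        have "\<bar>p - r\<bar> < h" using r idx[of p] p by (auto simp: algebra_simps abs_if)
        then have "r \<in> ball p e" using h by (auto simp: dist_real_def)
        then show "r \<in> U" using e(2) p by blast
      qed
      have disj: "disjoint_family_on (\<lambda>k. {real_of_int k * h<..<(real_of_int k + 1) * h}) S"
      proof -
        have "{real_of_int k * h<..<(real_of_int k + 1) * h} \<inter>
            {real_of_int l * h<..<(real_of_int l + 1) * h} = {}" if "k < l" for k l
        proof -
          have "real_of_int k + 1 \<le> real_of_int l" using that by linarith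
          then have "(real_of_int k + 1) * h \<le> real_of_int l * h"
            using h by (intro mult_right_mono) auto
          then show ?thesis by auto
        qed
        then show ?thesis unfolding disjoint_family_on_def
          by (metis Int_commute linorder_neqE)
      qed
      have "(\<Sum>k\<in>S. (real_of_int k + 1) * h - real_of_int k * h) \<le> \<delta> / 2"
        by (rule sum_disjoint_lengths_le[where S = U])
          (use finS disj sub U(1) lenU \<delta> h in \<open>auto simp: algebra_simps\<close>)
      then have len: "(\<Sum>k\<in>S. (real_of_int k + 1) * h - real_of_int k * h) < \<delta>"
        using \<delta> by linarith
      have small: "(\<Sum>k\<in>S. \<bar>F ((real_of_int k + 1) * h) - F (real_of_int k * h)\<bar>) < \<epsilon>"
        by (rule ac[rule_format], intro conjI ballI)
          (use finS disj len h in \<open>auto simp: algebra_simps\<close>)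
      have "emeasure ?\<mu> K \<le> emeasure ?\<mu> (\<Union>k\<in>S. {real_of_int k * h<..(real_of_int k + 1) * h})"
      proof (rule emeasure_mono)
        show "K \<subseteq> (\<Union>k\<in>S. {real_of_int k * h<..(real_of_int k + 1) * h})"
          using idx by (auto simp: S_def)
        show "(\<Union>k\<in>S. {real_of_int k * h<..(real_of_int k + 1) * h}) \<in> sets ?\<mu>"
          using finS by (auto intro!: sets.finite_UN)
      qed
      also have "\<dots> \<le> (\<Sum>k\<in>S. emeasure ?\<mu> {real_of_int k * h<..(real_of_int k + 1) * h})"
        using finS by (intro emeasure_subadditive_finite) auto
      also have "\<dots> = (\<Sum>k\<in>S. ennreal \<bar>F ((real_of_int k + 1) * h) - F (real_of_int k * h)\<bar>)"
      proof (rule sum.cong[OF refl])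
        fix k
        have le: "real_of_int k * h \<le> (real_of_int k + 1) * h" using h by (simp add: algebra_simps)
        show "emeasure ?\<mu> {real_of_int k * h<..(real_of_int k + 1) * h}
            = ennreal \<bar>F ((real_of_int k + 1) * h) - F (real_of_int k * h)\<bar>"
          using mono[OF le] by (subst emeasure_interval_measure_Ioc[OF le mono rcont]) auto
      qed
      also have "\<dots> = ennreal (\<Sum>k\<in>S. \<bar>F ((real_of_int k + 1) * h) - F (real_of_int k * h)\<bar>)"
        by (rule sum_ennreal) auto
      also have "\<dots> \<le> ennreal \<epsilon>" using small by (intro ennreal_leI) simp
      finally show ?thesis by simp
    qed
    then have "emeasure ?\<mu> K \<le> 0" by (rule ennreal_le_epsilon)
    then show ?thesis by simp
  qed
  then have "(SUP K\<in>{K. K \<subseteq> N \<and> compact K}. emeasure ?\<mu> K) \<le> 0"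
    by (intro SUP_least) auto
  moreover have "emeasure ?\<mu> N = (SUP K\<in>{K. K \<subseteq> N \<and> compact K}. emeasure ?\<mu> K)"
    using finite_interval_measure[OF mono cont const \<open>x \<le> y\<close>] N
    by (intro inner_regular) auto
  ultimately have "emeasure ?\<mu> N = 0" by simp
  then show "N \<in> null_sets ?\<mu>" using N by auto
qed

lemma increasing_absolutely_continuous_density:
  assumes mono: "\<And>s t. s \<le> t \<Longrightarrow> F s \<le> F t" and F: "absolutely_continuous_fun F"
    and const: "\<And>t. F (confine x y t) = F t" and "x \<le> y"
  obtains p where "integrable lborel p" "\<And>s t. s \<le> t \<Longrightarrow> (p has_integral (F t - F s)) {s..t}"
proof -
  let ?\<mu> = "interval_measure F"
  have cont: "continuous_on UNIV F" by (rule absolutely_continuous_fun_imp_continuous) fact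
  obtain q where q: "q \<in> borel_measurable lborel" "density lborel q = ?\<mu>"
    using sigma_finite_measure.Radon_Nikodym[OF sigma_finite_lborel
        interval_measure_absolutely_continuous[OF mono F const \<open>x \<le> y\<close>]]
    by auto
  have "(\<integral>\<^sup>+u. q u \<partial>lborel) = emeasure ?\<mu> UNIV"
    using q by (subst q(2)[symmetric], subst emeasure_density) auto
  also have "\<dots> \<noteq> \<infinity>" by (rule finite_interval_measure[OF mono cont const \<open>x \<le> y\<close>])
  finally have fin: "(\<integral>\<^sup>+u. q u \<partial>lborel) \<noteq> \<infinity>" .
  define p where "p u = enn2real (q u)" for u
  have "AE u in lborel. q u \<noteq> \<infinity>"
    by (rule nn_integral_PInf_AE[OF q(1) fin])
  then have pq: "AE u in lborel. ennreal (p u) = q u"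
    by eventually_elim (simp add: p_def less_top)
  have pm: "p \<in> borel_measurable lborel" using q(1) by (simp add: p_def[abs_def])
  have p: "integrable lborel p"
  proof (rule integrableI_nonneg[OF pm])
    show "AE u in lborel. 0 \<le> p u" by (simp add: p_def)
    have "(\<integral>\<^sup>+u. ennreal (p u) \<partial>lborel) = (\<integral>\<^sup>+u. q u \<partial>lborel)"
      by (rule nn_integral_cong_AE[OF pq])
    then show "(\<integral>\<^sup>+u. ennreal (p u) \<partial>lborel) < \<infinity>" using fin by (simp add: less_top)
  qed
  show ?thesis
  proof (rule that[OF p])
    fix s t :: real assume st: "s \<le> t"
    have int: "set_integrable lborel {s..t} p"
      unfolding set_integrable_def using integrable_mult_indicator[OF _ p, of "{s..t}"] by simp
    have "ennreal (F t - F s) = emeasure ?\<mu> {s..t}"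
      by (rule emeasure_interval_measure_Icc[symmetric, OF st mono cont])
    also have "\<dots> = (\<integral>\<^sup>+u. q u * indicator {s..t} u \<partial>lborel)"
      using q by (subst q(2)[symmetric], subst emeasure_density) auto
    also have "\<dots> = (\<integral>\<^sup>+u. ennreal (indicator {s..t} u *\<^sub>R p u) \<partial>lborel)"
      by (rule nn_integral_cong_AE) (use pq in eventually_elim, auto simp: indicator_def)
    also have "\<dots> = ennreal (LINT u:{s..t}|lborel. p u)"
      unfolding set_lebesgue_integral_def
      by (rule nn_integral_eq_integral) (use int in \<open>auto simp: set_integrable_def p_def\<close>)
    finally have "F t - F s = (LINT u:{s..t}|lborel. p u)"
      using mono[OF st] by (subst (asm) ennreal_inj)
        (auto simp: set_lebesgue_integral_def p_def intro!: integral_nonneg_AE)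
    then show "(p has_integral (F t - F s)) {s..t}"
      using has_integral_set_lebesgue has_integral_iff set_borel_integral_eq_integral[OF int] by metis
  qed
qed

section \<open>Differentiation of indefinite integrals\<close>

lemma right_derivative_indefinite_integral:
  fixes p :: "real \<Rightarrow> real"
  assumes p: "\<And>s t. s \<le> t \<Longrightarrow> (p has_integral (F t - F s)) {s..t}"
  obtains N where "negligible N"
    "\<And>t. t \<notin> N \<Longrightarrow> ((\<lambda>h. (F (t + h) - F t) / h) \<longlongrightarrow> p t) (at_right 0)"
proof -
  have "p integrable_on cbox s t" for s t
    using p[of s t] by (cases "s \<le> t") (auto simp: integrable_on_def)
  then obtain N where N: "negligible N" "\<And>x e. \<lbrakk>x \<notin> N; 0 < e\<rbrakk> \<Longrightarrow>
      \<exists>d>0. \<forall>h. 0 < h \<and> h < d \<longrightarrow>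
        norm (integral (cbox x (x + h *\<^sub>R One)) p /\<^sub>R h ^ DIM(real) - p x) < e"
    by (rule integrable_ccontinuous_explicit[of p]) blast
  show ?thesis
  proof (rule that[OF N(1)])
    fix t assume t: "t \<notin> N"
    show "((\<lambda>h. (F (t + h) - F t) / h) \<longlongrightarrow> p t) (at_right 0)"
    proof (rule tendstoI)
      fix e :: real assume "e > 0"
      then obtain d where d: "d > 0" "\<And>h. 0 < h \<Longrightarrow> h < d \<Longrightarrow>
          norm (integral (cbox t (t + h *\<^sub>R One)) p /\<^sub>R h ^ DIM(real) - p t) < e"
        using N(2)[OF t] by blast
      have "dist ((F (t + h) - F t) / h) (p t) < e" if "0 < h" "h < d" for h
        using d(2)[OF that] integral_unique[OF p[of t "t + h"]] that
        by (simp add: dist_norm divide_inverse mult.commute)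
      then show "\<forall>\<^sub>F h in at_right 0. dist ((F (t + h) - F t) / h) (p t) < e"
        using d(1) by (auto simp: eventually_at_right_field)
    qed
  qed
qed

text \<open>The left derivative of \<open>F\<close> at \<open>t\<close> is the right derivative at \<open>-t\<close> of the reflected function
\<open>\<lambda>t. - F (- t)\<close>, whose density is the reflected density.\<close>
lemma derivative_indefinite_integral:
  fixes p :: "real \<Rightarrow> real"
  assumes p: "\<And>s t. s \<le> t \<Longrightarrow> (p has_integral (F t - F s)) {s..t}"
  obtains N where "negligible N" "\<And>t. t \<notin> N \<Longrightarrow> (F has_real_derivative p t) (at t)"
proof -
  obtain N1 where N1: "negligible N1"
    "\<And>t. t \<notin> N1 \<Longrightarrow> ((\<lambda>h. (F (t + h) - F t) / h) \<longlongrightarrow> p t) (at_right 0)"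
    using right_derivative_indefinite_integral[OF p] by blast
  have "((\<lambda>u. p (- u)) has_integral (- F (- t) - - F (- s))) {s..t}" if "s \<le> t" for s t
    using p[of "- t" "- s"] that has_integral_reflect_real[of p "F (- s) - F (- t)" "- s" "- t"]
    by simp
  then obtain N2 where N2: "negligible N2"
    "\<And>t. t \<notin> N2 \<Longrightarrow> ((\<lambda>h. (- F (- (t + h)) - - F (- t)) / h) \<longlongrightarrow> p (- t)) (at_right 0)"
    using right_derivative_indefinite_integral[of "\<lambda>u. p (- u)" "\<lambda>t. - F (- t)"] by blast
  have N2': "negligible (uminus ` N2)"
    by (rule negligible_differentiable_image_negligible)
      (auto simp: N2 differentiable_on_def intro!: derivative_intros)
  show ?thesis
  proof (rule that[of "N1 \<union> uminus ` N2"])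
    show "negligible (N1 \<union> uminus ` N2)" using N1 N2' by simp
    fix t assume t: "t \<notin> N1 \<union> uminus ` N2"
    then have "- t \<notin> N2" by force
    then have "((\<lambda>h. (- F (- (- t + h)) - - F (- (- t))) / h) \<longlongrightarrow> p (- (- t))) (at_right 0)"
      by (rule N2(2))
    moreover have "(- F (- (- t + h)) - - F (- (- t))) / h = (F (t + - h) - F t) / - h" for h
      by (simp add: minus_divide_right[symmetric] diff_divide_distrib)
    ultimately have "((\<lambda>h. (F (t + h) - F t) / h) \<longlongrightarrow> p t) (at_left 0)"
      unfolding filterlim_at_left_to_right by simp
    moreover have "((\<lambda>h. (F (t + h) - F t) / h) \<longlongrightarrow> p t) (at_right 0)"
      using N1(2) t by simp
    ultimately have "((\<lambda>h. (F (t + h) - F t) / h) \<longlongrightarrow> p t) (at 0)"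
      by (rule filterlim_split_at)
    then show "(F has_real_derivative p t) (at t)" by (simp add: DERIV_def)
  qed
qed

text \<open>Lebesgue's fundamental theorem of calculus. Up to constant continuation outside \<open>[x, y]\<close>, the
function is \<open>V - Q\<close> where \<open>V\<close> is its variation from \<open>x\<close> and both \<open>V\<close> and \<open>Q\<close> are increasing and
absolutely continuous.\<close>
proposition absolutely_continuous_fun_deriv:
  assumes f: "absolutely_continuous_fun f" and "x \<le> y"
  shows "(deriv f) absolutely_integrable_on {x..y}"
    and "(deriv f has_integral (f y - f x)) {x..y}"
proof -
  define V where "V t = variation f x (confine x y t)" for t
  define g where "g t = f (confine x y t)" for t
  define Q where "Q t = V t - g t" for t
  have idem: "confine x y (confine x y t) = confine x y t" for t
    using \<open>x \<le> y\<close> by (auto simp: confine_def)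
  have inc: "\<bar>g t - g s\<bar> \<le> V t - V s" if "s \<le> t" for s t
    unfolding g_def V_def
    using variation_increment[OF f, of x "confine x y s" "confine x y t"] confine_mono[OF that]
    by (auto simp: confine_def)
  have V: "absolutely_continuous_fun V"
    unfolding V_def[abs_def] by (rule absolutely_continuous_variation) fact+
  have Q: "absolutely_continuous_fun Q"
    unfolding Q_def[abs_def] g_def
    by (intro absolutely_continuous_fun_diff V absolutely_continuous_fun_confine f)
  obtain p where p: "integrable lborel p" "\<And>s t. s \<le> t \<Longrightarrow> (p has_integral (V t - V s)) {s..t}"
    by (rule increasing_absolutely_continuous_density[OF _ V _ \<open>x \<le> y\<close>])
      (use inc idem in \<open>force simp: V_def\<close>)+
  obtain q where q: "integrable lborel q" "\<And>s t. s \<le> t \<Longrightarrow> (q has_integral (Q t - Q s)) {s..t}"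
    by (rule increasing_absolutely_continuous_density[OF _ Q _ \<open>x \<le> y\<close>])
      (use inc idem in \<open>force simp: V_def g_def Q_def\<close>)+
  obtain M where M: "negligible M" "\<And>t. t \<notin> M \<Longrightarrow> (V has_real_derivative p t) (at t)"
    using derivative_indefinite_integral[OF p(2)] by blast
  obtain N where N: "negligible N" "\<And>t. t \<notin> N \<Longrightarrow> (Q has_real_derivative q t) (at t)"
    using derivative_indefinite_integral[OF q(2)] by blast
  \<comment> \<open>The endpoints are excluded because the constant continuation agrees with \<open>f\<close> only inside.\<close>
  have neg: "negligible (M \<union> N \<union> {x, y})" using M N by simp
  have eq: "deriv f t = p t - q t" if "t \<in> {x..y} - (M \<union> N \<union> {x, y})" for t
  proof (rule DERIV_imp_deriv)
    have "((\<lambda>t. V t - Q t) has_real_derivative p t - q t) (at t)"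
      using that by (intro DERIV_diff M N) auto
    then show "(f has_real_derivative p t - q t) (at t)"
      by (rule has_field_derivative_transform_within_open[of _ _ _ "{x<..<y}"])
        (use that in \<open>auto simp: Q_def g_def confine_def\<close>)
  qed
  have "integrable lborel (\<lambda>t. p t - q t)" using p(1) q(1) by simp
  then have "integrable lebesgue (\<lambda>t. p t - q t)"
    using integrable_completion[of "\<lambda>t. p t - q t" lborel] borel_measurable_integrable by blast
  then have "(\<lambda>t. p t - q t) absolutely_integrable_on {x..y}"
    unfolding set_integrable_def using integrable_mult_indicator[of "{x..y}" lebesgue "\<lambda>t. p t - q t"] by simp
  then show "(deriv f) absolutely_integrable_on {x..y}"
    by (rule absolutely_integrable_spike[OF _ neg]) (use eq in auto)
  have "((\<lambda>t. p t - q t) has_integral ((V y - V x) - (Q y - Q x))) {x..y}"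
    using p(2)[OF \<open>x \<le> y\<close>] q(2)[OF \<open>x \<le> y\<close>] by (rule has_integral_diff)
  then have "((\<lambda>t. p t - q t) has_integral (f y - f x)) {x..y}"
    using \<open>x \<le> y\<close> by (simp add: Q_def g_def confine_def)
  then show "(deriv f has_integral (f y - f x)) {x..y}"
    by (rule has_integral_spike[OF neg, rotated]) (use eq in auto)
qed

lemma absolutely_continuous_fun_increment_le:
  assumes f: "absolutely_continuous_fun f" and "x \<le> y"
  shows "f y - f x \<le> (LINT t:{x..y}|lebesgue. \<bar>deriv f t\<bar>)"
proof -
  note d = absolutely_continuous_fun_deriv[OF assms]
  have abs: "(\<lambda>t. \<bar>deriv f t\<bar>) absolutely_integrable_on {x..y}"
    using absolutely_integrable_norm[OF d(1)] by (simp add: o_def)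
  have "((\<lambda>t. \<bar>deriv f t\<bar>) has_integral integral {x..y} (\<lambda>t. \<bar>deriv f t\<bar>)) {x..y}"
    using set_lebesgue_integral_eq_integral(1)[OF abs] by (rule integrable_integral)
  then have "f y - f x \<le> integral {x..y} (\<lambda>t. \<bar>deriv f t\<bar>)"
    by (rule has_integral_le[OF d(2)]) auto
  then show ?thesis using set_lebesgue_integral_eq_integral(2)[OF abs] by simp
qed

lemma integral_abs_deriv_mono:
  assumes f: "absolutely_continuous_fun f" and "x \<le> a" "a \<le> b" "b \<le> y"
  shows "(LINT t:{a..b}|lebesgue. \<bar>deriv f t\<bar>) \<le> (LINT t:{x..y}|lebesgue. \<bar>deriv f t\<bar>)"
proof -
  have abs: "(\<lambda>t. \<bar>deriv f t\<bar>) absolutely_integrable_on {s..t}" if "s \<le> t" for s t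
    using absolutely_integrable_norm[OF absolutely_continuous_fun_deriv(1)[OF f that]]
    by (simp add: o_def)
  have "integral {a..b} (\<lambda>t. \<bar>deriv f t\<bar>) \<le> integral {x..y} (\<lambda>t. \<bar>deriv f t\<bar>)"
    using assms by (intro integral_subset_le set_lebesgue_integral_eq_integral(1) abs) auto
  then show ?thesis
    using assms by (simp add: set_lebesgue_integral_eq_integral(2)[OF abs])
qed

section \<open>One-sided velocities of piecewise twice differentiable paths\<close>

lemma C2_on_subset:
  assumes "C2_on f I" "J \<subseteq> I"
  shows "C2_on f J"
proof -
  obtain g h where "\<forall>t\<in>I. (f has_real_derivative g t) (at t within I)"
    "\<forall>t\<in>I. (g has_real_derivative h t) (at t within I)" "continuous_on I h"
    using assms(1) unfolding C2_on_def by blast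
  then show ?thesis
    using assms(2) unfolding C2_on_def
    by (intro exI[of _ g] exI[of _ h])
      (auto intro: has_field_derivative_subset continuous_on_subset)
qed

lemma piecewise_C2_imp_left:
  assumes "piecewise_C2 f" "0 < t"
  obtains a where "a < t" "C2_on f {a..t}"
proof -
  obtain n :: nat and \<tau> where \<tau>: "\<tau> 0 = 0" "\<forall>k<n. \<tau> k < \<tau> (Suc k)"
    "\<forall>k<n. C2_on f {\<tau> k..\<tau> (Suc k)}" "C2_on f {\<tau> n..}"
    using assms(1) unfolding piecewise_C2_def by blast
  let ?K = "{k. k \<le> n \<and> \<tau> k < t}"
  define k where "k = Max ?K"
  have K: "finite ?K" "0 \<in> ?K" using \<tau> assms(2) by auto
  have k: "k \<le> n" "\<tau> k < t" proof -
    have "k \<in> ?K" unfolding k_def by (rule Max_in[OF K(1)]) (use K(2) in blast)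
    then show "k \<le> n" "\<tau> k < t" by auto
  qed
  show ?thesis
  proof (cases "k = n")
    case True
    then show ?thesis
      using k by (intro that[of "\<tau> n"], simp) (rule C2_on_subset[OF \<tau>(4)], auto)
  next
    case False
    then have "\<not> \<tau> (Suc k) < t"
      using Max_ge[OF K(1), of "Suc k"] k unfolding k_def[symmetric] by auto
    then show ?thesis
      using k False \<tau>(3)
      by (intro that[of "\<tau> k"], simp) (rule C2_on_subset[of f "{\<tau> k..\<tau> (Suc k)}"], auto)
  qed
qed

lemma piecewise_C2_imp_right:
  assumes "piecewise_C2 f" "0 \<le> t"
  obtains b where "t < b" "C2_on f {t..b}"
proof -
  obtain n :: nat and \<tau> where \<tau>: "\<tau> 0 = 0" "\<forall>k<n. \<tau> k < \<tau> (Suc k)"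
    "\<forall>k<n. C2_on f {\<tau> k..\<tau> (Suc k)}" "C2_on f {\<tau> n..}"
    using assms(1) unfolding piecewise_C2_def by blast
  let ?K = "{k. k \<le> n \<and> \<tau> k \<le> t}"
  define k where "k = Max ?K"
  have K: "finite ?K" "0 \<in> ?K" using \<tau> assms(2) by auto
  have k: "k \<le> n" "\<tau> k \<le> t" proof -
    have "k \<in> ?K" unfolding k_def by (rule Max_in[OF K(1)]) (use K(2) in blast)
    then show "k \<le> n" "\<tau> k \<le> t" by auto
  qed
  show ?thesis
  proof (cases "k = n")
    case True
    then show ?thesis
      using k by (intro that[of "t + 1"], simp) (rule C2_on_subset[OF \<tau>(4)], auto)
  next
    case False
    then have "\<not> \<tau> (Suc k) \<le> t"
      using Max_ge[OF K(1), of "Suc k"] k unfolding k_def[symmetric] by auto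
    then show ?thesis
      using k False \<tau>(3)
      by (intro that[of "\<tau> (Suc k)"], simp) (rule C2_on_subset[of f "{\<tau> k..\<tau> (Suc k)}"], auto)
  qed
qed

text \<open>At a breakpoint the velocity has a left limit, and this limit is also the left derivative of the
path. The first fact makes the Wronskian converge, the second compares the velocities of particles
that meet.\<close>
lemma left_velocity_piecewise_C2:
  assumes "piecewise_C2 f" "0 < t"
  shows "(deriv f \<longlongrightarrow> left_velocity f t) (at_left t)"
    and "(f has_real_derivative left_velocity f t) (at_left t)"
proof -
  obtain a where a: "a < t" "C2_on f {a..t}" by (rule piecewise_C2_imp_left[OF assms])
  then obtain g h where g: "\<And>s. s \<in> {a..t} \<Longrightarrow> (f has_real_derivative g s) (at s within {a..t})"
    and h: "\<And>s. s \<in> {a..t} \<Longrightarrow> (g has_real_derivative h s) (at s within {a..t})"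
    unfolding C2_on_def by blast
  have "(g \<longlongrightarrow> g t) (at_left t)"
    using DERIV_continuous[OF h[of t]] a by (simp add: continuous_within at_within_Icc_at_left)
  moreover have "\<forall>\<^sub>F s in at_left t. g s = deriv f s"
    unfolding eventually_at_left_field
  proof (intro exI[of _ a] conjI allI impI a(1))
    fix s assume s: "a < s" "s < t"
    then have "(f has_real_derivative g s) (at s)"
      using g[of s] at_within_interior[of s "{a..t}"] by simp
    then show "g s = deriv f s" by (simp add: DERIV_imp_deriv)
  qed
  ultimately have lim: "(deriv f \<longlongrightarrow> g t) (at_left t)"
    by (rule Lim_transform_eventually)
  then have eq: "left_velocity f t = g t"
    unfolding left_velocity_def by (intro tendsto_Lim) auto
  show "(deriv f \<longlongrightarrow> left_velocity f t) (at_left t)"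
    using lim eq by simp
  show "(f has_real_derivative left_velocity f t) (at_left t)"
    using g[of t] a eq by (simp add: at_within_Icc_at_left)
qed

lemma right_velocity_piecewise_C2:
  assumes "piecewise_C2 f" "0 \<le> t"
  shows "(deriv f \<longlongrightarrow> right_velocity f t) (at_right t)"
    and "(f has_real_derivative right_velocity f t) (at_right t)"
proof -
  obtain b where b: "t < b" "C2_on f {t..b}" by (rule piecewise_C2_imp_right[OF assms])
  then obtain g h where g: "\<And>s. s \<in> {t..b} \<Longrightarrow> (f has_real_derivative g s) (at s within {t..b})"
    and h: "\<And>s. s \<in> {t..b} \<Longrightarrow> (g has_real_derivative h s) (at s within {t..b})"
    unfolding C2_on_def by blast
  have "(g \<longlongrightarrow> g t) (at_right t)"
    using DERIV_continuous[OF h[of t]] b by (simp add: continuous_within at_within_Icc_at_right)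
  moreover have "\<forall>\<^sub>F s in at_right t. g s = deriv f s"
    unfolding eventually_at_right_field
  proof (intro exI[of _ b] conjI allI impI b(1))
    fix s assume s: "t < s" "s < b"
    then have "(f has_real_derivative g s) (at s)"
      using g[of s] at_within_interior[of s "{t..b}"] by simp
    then show "g s = deriv f s" by (simp add: DERIV_imp_deriv)
  qed
  ultimately have lim: "(deriv f \<longlongrightarrow> g t) (at_right t)"
    by (rule Lim_transform_eventually)
  then have eq: "right_velocity f t = g t"
    unfolding right_velocity_def by (intro tendsto_Lim) auto
  show "(deriv f \<longlongrightarrow> right_velocity f t) (at_right t)"
    using lim eq by simp
  show "(f has_real_derivative right_velocity f t) (at_right t)"
    using g[of t] b eq by (simp add: at_within_Icc_at_right)
qed

lemma left_derivative_nonpos: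
  fixes f :: "real \<Rightarrow> real"
  assumes f: "(f has_real_derivative D) (at_left t)" and ft: "f t = 0"
    and nonneg: "\<forall>\<^sub>F s in at_left t. 0 \<le> f s"
  shows "D \<le> 0"
proof (rule tendsto_upperbound)
  show "((\<lambda>s. (f s - f t) / (s - t)) \<longlongrightarrow> D) (at_left t)"
    using f by (simp add: has_field_derivative_iff)
  have "\<forall>\<^sub>F s in at_left t. s < t" by (simp add: eventually_at_filter)
  with nonneg show "\<forall>\<^sub>F s in at_left t. (f s - f t) / (s - t) \<le> 0"
    by eventually_elim (simp add: ft divide_nonneg_neg)
qed auto

text \<open>A finite exceptional set is allowed because the velocities, but not the paths, jump at collisions.\<close>
lemma nonincreasing_off_finite:
  fixes h :: "real \<Rightarrow> real"
  assumes S: "finite S" and "a \<le> b" and cont: "continuous_on {a..b} h"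
    and deriv: "\<And>r. r \<in> {a<..<b} - S \<Longrightarrow> (h has_real_derivative h' r) (at r)"
    and nonpos: "\<And>r. r \<in> {a<..<b} - S \<Longrightarrow> h' r \<le> 0"
  shows "h b \<le> h a"
proof -
  define k where "k r = (if r \<in> {a<..<b} - S then h' r else 0)" for r
  have "(k has_integral (h b - h a)) {a..b}"
    by (rule fundamental_theorem_of_calculus_interior_strong[OF S \<open>a \<le> b\<close> _ cont])
      (use deriv in \<open>auto simp: k_def has_real_derivative_iff_has_vector_derivative\<close>)
  moreover have "((\<lambda>_. 0) has_integral (0::real)) {a..b}" by (rule has_integral_0)
  ultimately have "h b - h a \<le> 0"
    by (rule has_integral_le) (use nonpos in \<open>auto simp: k_def\<close>)
  then show ?thesis by simp
qed

lemma eventually_at_left_not_in_finite: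
  fixes t :: real
  assumes "finite S"
  shows "\<forall>\<^sub>F s in at_left t. s \<notin> S"
proof -
  have "open (- (S - {t}))" using assms by (intro open_Compl finite_imp_closed) auto
  then show ?thesis
    by (auto simp: eventually_at_topological intro!: exI[of _ "- (S - {t})"])
qed

lemma weighted_average_le:
  fixes m w :: "'i \<Rightarrow> real"
  assumes "finite A" "A \<noteq> {}" "\<And>k. k \<in> A \<Longrightarrow> 0 < m k" "\<And>k. k \<in> A \<Longrightarrow> w k \<le> C"
  shows "(\<Sum>k\<in>A. m k * w k) / (\<Sum>k\<in>A. m k) \<le> C"
proof -
  have "(\<Sum>k\<in>A. m k * w k) \<le> (\<Sum>k\<in>A. m k * C)"
    using assms by (intro sum_mono mult_left_mono) (auto intro: less_imp_le)
  also have "\<dots> = C * (\<Sum>k\<in>A. m k)" by (simp add: sum_distrib_left mult.commute)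
  finally show ?thesis using sum_pos[OF assms(1,2), of m] assms(3) by (simp add: pos_divide_le_eq)
qed

lemma weighted_average_ge:
  fixes m w :: "'i \<Rightarrow> real"
  assumes "finite A" "A \<noteq> {}" "\<And>k. k \<in> A \<Longrightarrow> 0 < m k" "\<And>k. k \<in> A \<Longrightarrow> C \<le> w k"
  shows "C \<le> (\<Sum>k\<in>A. m k * w k) / (\<Sum>k\<in>A. m k)"
  using weighted_average_le[of A m "\<lambda>k. - w k" "- C"] assms by (simp add: sum_negf)

section \<open>Order and collisions of sticky particles\<close>

text \<open>The force enters the argument only through \<open>slope_bound\<close>, the monotonicity of \<open>W' + c id\<close>.\<close>
locale sticky_particles =
  fixes W :: "real \<Rightarrow> real" and c :: real and N :: nat
    and m x v :: "nat \<Rightarrow> real" and \<gamma> :: "nat \<Rightarrow> real \<Rightarrow> real"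
  assumes slope_bound: "\<And>p q. q \<le> p \<Longrightarrow> deriv W q + c * q \<le> deriv W p + c * p"
    and mass_pos: "\<And>k. k \<in> {1..N} \<Longrightarrow> 0 < m k"
    and total_mass: "(\<Sum>k=1..N. m k) = 1"
    and sticky: "sticky_particle_trajectories W N m x v \<gamma>"
begin

abbreviation acceleration :: "nat \<Rightarrow> real \<Rightarrow> real" where
  "acceleration k t \<equiv> - (\<Sum>j=1..N. m j * deriv W (\<gamma> k t - \<gamma> j t))"

text \<open>The times at which some particle violates the equation of motion. They include all collisions with
a genuine change of velocity, because a path with a second derivative has a continuous velocity.\<close>
definition singular_times :: "real set" where
  "singular_times = (\<Union>k\<in>{1..N}. {t. 0 < t \<and> \<not> has_second_deriv (\<gamma> k) (acceleration k t) t})"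

lemmas sticky_conditions = sticky[unfolded sticky_particle_trajectories_def]

lemma finite_singular_times: "finite singular_times"
  unfolding singular_times_def
  by (rule finite_UN_I[OF finite_atLeastAtMost]) (rule bspec[OF sticky_conditions[THEN conjunct2, THEN conjunct1]])

lemma piecewise: "k \<in> {1..N} \<Longrightarrow> piecewise_C2 (\<gamma> k)"
  and continuous_path: "k \<in> {1..N} \<Longrightarrow> continuous_on {0..} (\<gamma> k)"
  using sticky_conditions[THEN conjunct1] by auto

lemma initial_position: "k \<in> {1..N} \<Longrightarrow> \<gamma> k 0 = x k"
  and initial_velocity: "k \<in> {1..N} \<Longrightarrow> (\<gamma> k has_real_derivative v k) (at 0 within {0..})"
  using sticky_conditions[THEN conjunct2, THEN conjunct2, THEN conjunct1] by auto

lemma merged: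
  assumes "k \<in> {1..N}" "l \<in> {1..N}" "0 \<le> s" "s \<le> t" "\<gamma> k s = \<gamma> l s"
  shows "\<gamma> k t = \<gamma> l t"
  using sticky_conditions[THEN conjunct2, THEN conjunct2, THEN conjunct2, THEN conjunct1] assms by blast

text \<open>If the order of two paths were reversed, they would have met before, and would have stayed together
since then.\<close>
lemma order_preserved:
  assumes kl: "k \<in> {1..N}" "l \<in> {1..N}" and "x l \<le> x k" "0 \<le> t"
  shows "\<gamma> l t \<le> \<gamma> k t"
proof (rule ccontr)
  assume "\<not> \<gamma> l t \<le> \<gamma> k t"
  then have neg: "\<gamma> k t - \<gamma> l t < 0" by simp
  have "continuous_on {0..t} (\<lambda>s. \<gamma> k s - \<gamma> l s)"
    using kl by (intro continuous_on_diff) (auto intro: continuous_on_subset[OF continuous_path])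
  then obtain s where s: "0 \<le> s" "s \<le> t" "\<gamma> k s - \<gamma> l s = 0"
    using IVT2'[of "\<lambda>s. \<gamma> k s - \<gamma> l s" t 0 0] neg assms initial_position by force
  have "\<gamma> k t = \<gamma> l t"
    by (rule merged[OF kl s(1,2)]) (use s(3) in simp)
  then show False using neg by simp
qed

lemma right_velocity_0:
  assumes k: "k \<in> {1..N}"
  shows "right_velocity (\<gamma> k) 0 = v k"
proof (rule tendsto_unique[OF trivial_limit_at_right_real[of "0::real"]])
  have "(\<gamma> k has_real_derivative v k) (at_right 0)"
    by (rule has_field_derivative_subset[OF initial_velocity[OF k]]) auto
  then show "((\<lambda>s. (\<gamma> k s - \<gamma> k 0) / (s - 0)) \<longlongrightarrow> v k) (at_right 0)"
    by (simp add: has_field_derivative_iff)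
  show "((\<lambda>s. (\<gamma> k s - \<gamma> k 0) / (s - 0)) \<longlongrightarrow> right_velocity (\<gamma> k) 0) (at_right 0)"
    using right_velocity_piecewise_C2(2)[OF piecewise[OF k], of 0] by (simp add: has_field_derivative_iff)
qed

definition cluster :: "nat \<Rightarrow> real \<Rightarrow> nat set" where
  "cluster k t = {i \<in> {1..N}. \<gamma> i t = \<gamma> k t}"

lemma right_velocity_cluster:
  assumes "k \<in> {1..N}" "0 < t"
  shows "right_velocity (\<gamma> k) t =
    (\<Sum>i\<in>cluster k t. m i * left_velocity (\<gamma> i) t) / (\<Sum>i\<in>cluster k t. m i)"
  by (rule sticky_conditions[THEN conjunct2, THEN conjunct2, THEN conjunct2, THEN conjunct2, rule_format,
        of t "cluster k t" k])
    (use assms in \<open>auto simp: cluster_def\<close>)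

text \<open>The difference \<open>\<gamma> k - \<gamma> l\<close> is nonnegative before \<open>t\<close> and vanishes at \<open>t\<close>.\<close>
lemma left_velocity_converging:
  assumes kl: "k \<in> {1..N}" "l \<in> {1..N}" and "x l \<le> x k" "0 < t" "\<gamma> k t = \<gamma> l t"
  shows "left_velocity (\<gamma> k) t \<le> left_velocity (\<gamma> l) t"
proof -
  have "left_velocity (\<gamma> k) t - left_velocity (\<gamma> l) t \<le> 0"
  proof (rule left_derivative_nonpos)
    show "((\<lambda>s. \<gamma> k s - \<gamma> l s) has_real_derivative
        left_velocity (\<gamma> k) t - left_velocity (\<gamma> l) t) (at_left t)"
      using kl \<open>0 < t\<close> by (intro DERIV_diff left_velocity_piecewise_C2 piecewise)
    show "\<forall>\<^sub>F s in at_left t. 0 \<le> \<gamma> k s - \<gamma> l s"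
      unfolding eventually_at_left_field
      using assms by (intro exI[of _ 0]) (auto simp: order_preserved)
  qed (use assms in simp)
  then show ?thesis by simp
qed

text \<open>The witness is the member of the cluster of \<open>k\<close> that started furthest to the left: by
\<open>left_velocity_converging\<close> it arrives with the largest velocity, which bounds the average.\<close>
lemma right_velocity_le_left_velocity:
  assumes k: "k \<in> {1..N}" and "0 < t"
  obtains d where "d \<in> {1..N}" "\<gamma> d t = \<gamma> k t" "x d \<le> x k"
    "right_velocity (\<gamma> k) t \<le> left_velocity (\<gamma> d) t"
proof -
  have C: "finite (cluster k t)" "k \<in> cluster k t" using k by (auto simp: cluster_def)
  then obtain d where d: "d \<in> cluster k t" "\<And>i. i \<in> cluster k t \<Longrightarrow> x d \<le> x i"
    using ex_is_arg_min_if_finite[of "cluster k t" x] by (fastforce simp: is_arg_min_linorder)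
  show ?thesis
  proof (rule that[of d])
    have "left_velocity (\<gamma> i) t \<le> left_velocity (\<gamma> d) t" if "i \<in> cluster k t" for i
      using d that \<open>0 < t\<close> by (intro left_velocity_converging) (auto simp: cluster_def)
    then show "right_velocity (\<gamma> k) t \<le> left_velocity (\<gamma> d) t"
      unfolding right_velocity_cluster[OF assms]
      using C mass_pos by (intro weighted_average_le) (auto simp: cluster_def)
  qed (use d C in \<open>auto simp: cluster_def\<close>)
qed

lemma left_velocity_le_right_velocity:
  assumes k: "k \<in> {1..N}" and "0 < t"
  obtains e where "e \<in> {1..N}" "\<gamma> e t = \<gamma> k t" "x k \<le> x e"
    "left_velocity (\<gamma> e) t \<le> right_velocity (\<gamma> k) t"
proof -
  have C: "finite (cluster k t)" "k \<in> cluster k t" using k by (auto simp: cluster_def)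
  then obtain e where e: "e \<in> cluster k t" "\<And>i. i \<in> cluster k t \<Longrightarrow> x i \<le> x e"
    using ex_is_arg_min_if_finite[of "cluster k t" "\<lambda>i. - x i"]
    by (fastforce simp: is_arg_min_linorder)
  show ?thesis
  proof (rule that[of e])
    have "left_velocity (\<gamma> e) t \<le> left_velocity (\<gamma> i) t" if "i \<in> cluster k t" for i
      using e that \<open>0 < t\<close> by (intro left_velocity_converging) (auto simp: cluster_def)
    then show "left_velocity (\<gamma> e) t \<le> right_velocity (\<gamma> k) t"
      unfolding right_velocity_cluster[OF assms]
      using C mass_pos by (intro weighted_average_ge) (auto simp: cluster_def)
  qed (use e C in \<open>auto simp: cluster_def\<close>)
qed

text \<open>Every summand of the difference satisfies the bound by the monotonicity of \<open>W' + c id\<close>, and the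
weights \<open>m j\<close> add up to 1.\<close>
lemma acceleration_diff_le:
  assumes "k \<in> {1..N}" "l \<in> {1..N}" "\<gamma> l t \<le> \<gamma> k t"
  shows "acceleration k t - acceleration l t \<le> c * (\<gamma> k t - \<gamma> l t)"
proof -
  have "acceleration k t - acceleration l t
      = (\<Sum>j=1..N. m j * (deriv W (\<gamma> l t - \<gamma> j t) - deriv W (\<gamma> k t - \<gamma> j t)))"
    by (simp add: sum_subtractf right_diff_distrib)
  also have "\<dots> \<le> (\<Sum>j=1..N. m j * (c * (\<gamma> k t - \<gamma> l t)))"
  proof (intro sum_mono mult_left_mono)
    fix j
    show "deriv W (\<gamma> l t - \<gamma> j t) - deriv W (\<gamma> k t - \<gamma> j t) \<le> c * (\<gamma> k t - \<gamma> l t)"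
      using slope_bound[of "\<gamma> l t - \<gamma> j t" "\<gamma> k t - \<gamma> j t"] assms(3) by (simp add: algebra_simps)
  qed (use mass_pos less_imp_le in blast)
  also have "\<dots> = c * (\<gamma> k t - \<gamma> l t)"
    by (simp only: sum_distrib_right[symmetric] total_mass mult_1)
  finally show ?thesis .
qed

lemma regular_time:
  assumes "k \<in> {1..N}" "0 < t" "t \<notin> singular_times"
  shows "(\<gamma> k has_real_derivative deriv (\<gamma> k) t) (at t)"
    and "(deriv (\<gamma> k) has_real_derivative acceleration k t) (at t)"
proof -
  have "has_second_deriv (\<gamma> k) (acceleration k t) t"
    using assms by (auto simp: singular_times_def)
  then show "(\<gamma> k has_real_derivative deriv (\<gamma> k) t) (at t)"
    and "(deriv (\<gamma> k) has_real_derivative acceleration k t) (at t)"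
    unfolding has_second_deriv_def
    by (auto dest!: eventually_nhds_x_imp_x simp: DERIV_deriv_iff_real_differentiable)
qed

section \<open>Comparison with solutions of the linearised equation\<close>

text \<open>The Wronskian \<open>y' f - y f'\<close> of the separation \<open>y = \<gamma> k - \<gamma> l\<close> and a comparison function \<open>f\<close>. The
derivative of \<open>f\<close> is a parameter, to be instantiated with a closed formula.\<close>
definition wronskian :: "(real \<Rightarrow> real) \<Rightarrow> (real \<Rightarrow> real) \<Rightarrow> nat \<Rightarrow> nat \<Rightarrow> real \<Rightarrow> real" where
  "wronskian f f' k l t = (deriv (\<gamma> k) t - deriv (\<gamma> l) t) * f t - (\<gamma> k t - \<gamma> l t) * f' t"

text \<open>The derivative of the Wronskian is \<open>y'' f - y f'' = (y'' - c y) f\<close>, which is nonpositive.\<close>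
lemma wronskian_antimono:
  assumes kl: "k \<in> {1..N}" "l \<in> {1..N}" "x l \<le> x k"
    and f: "\<And>t. (f has_real_derivative f' t) (at t)" "\<And>t. (f' has_real_derivative c * f t) (at t)"
    and f_nonneg: "\<And>t. 0 \<le> t \<Longrightarrow> 0 \<le> f t"
    and st: "0 < s" "s \<le> t" "{s..t} \<inter> singular_times = {}"
  shows "wronskian f f' k l t \<le> wronskian f f' k l s"
proof (rule DERIV_nonpos_imp_nonincreasing[OF st(2)])
  fix r assume r: "s \<le> r" "r \<le> t"
  then have reg: "0 < r" "r \<notin> singular_times" using st by auto
  let ?a = "acceleration k r - acceleration l r - c * (\<gamma> k r - \<gamma> l r)"
  have "(wronskian f f' k l has_real_derivative ?a * f r) (at r)"
    unfolding wronskian_def[abs_def]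
    by (rule derivative_eq_intros regular_time[OF kl(1) reg] regular_time[OF kl(2) reg] f refl)+
      (simp add: algebra_simps)
  moreover have "?a * f r \<le> 0"
    using acceleration_diff_le[OF kl(1,2) order_preserved[OF kl]] f_nonneg[of r] reg
    by (intro mult_nonpos_nonneg) auto
  ultimately show "\<exists>y. (wronskian f f' k l has_real_derivative y) (at r) \<and> y \<le> 0" by blast
qed

lemma wronskian_at_right:
  assumes kl: "k \<in> {1..N}" "l \<in> {1..N}" and "0 \<le> s"
    and f: "\<And>t. (f has_real_derivative f' t) (at t)" "\<And>t. (f' has_real_derivative c * f t) (at t)"
  shows "(wronskian f f' k l \<longlongrightarrow>
    (right_velocity (\<gamma> k) s - right_velocity (\<gamma> l) s) * f s - (\<gamma> k s - \<gamma> l s) * f' s) (at_right s)"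
proof -
  have "(\<gamma> i \<longlongrightarrow> \<gamma> i s) (at_right s)" if "i \<in> {1..N}" for i
    using DERIV_continuous[OF right_velocity_piecewise_C2(2)[OF piecewise[OF that] \<open>0 \<le> s\<close>]]
    by (simp add: continuous_within)
  moreover have "(f \<longlongrightarrow> f s) (at_right s)" "(f' \<longlongrightarrow> f' s) (at_right s)"
    using continuous_at_imp_continuous_within[OF DERIV_isCont[OF f(1)]]
      continuous_at_imp_continuous_within[OF DERIV_isCont[OF f(2)]]
    unfolding continuous_within by blast+
  ultimately show ?thesis
    unfolding wronskian_def[abs_def] using kl
    by (intro tendsto_intros right_velocity_piecewise_C2(1) piecewise \<open>0 \<le> s\<close>) auto
qed

lemma wronskian_at_left:
  assumes kl: "k \<in> {1..N}" "l \<in> {1..N}" and "0 < s"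
    and f: "\<And>t. (f has_real_derivative f' t) (at t)" "\<And>t. (f' has_real_derivative c * f t) (at t)"
  shows "(wronskian f f' k l \<longlongrightarrow>
    (left_velocity (\<gamma> k) s - left_velocity (\<gamma> l) s) * f s - (\<gamma> k s - \<gamma> l s) * f' s) (at_left s)"
proof -
  have "(\<gamma> i \<longlongrightarrow> \<gamma> i s) (at_left s)" if "i \<in> {1..N}" for i
    using DERIV_continuous[OF left_velocity_piecewise_C2(2)[OF piecewise[OF that] \<open>0 < s\<close>]]
    by (simp add: continuous_within)
  moreover have "(f \<longlongrightarrow> f s) (at_left s)" "(f' \<longlongrightarrow> f' s) (at_left s)"
    using continuous_at_imp_continuous_within[OF DERIV_isCont[OF f(1)]]
      continuous_at_imp_continuous_within[OF DERIV_isCont[OF f(2)]]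
    unfolding continuous_within by blast+
  ultimately show ?thesis
    unfolding wronskian_def[abs_def] using kl
    by (intro tendsto_intros left_velocity_piecewise_C2(1) piecewise \<open>0 < s\<close>) auto
qed

text \<open>Let \<open>s\<close> be the last singular time before \<open>t\<close>, or 0 if there is none. The Wronskian at \<open>t\<close> is at
most its right limit at \<open>s\<close>. If \<open>s = 0\<close>, this limit is the initial value. If the two particles
have merged at \<open>s\<close>, it is 0. Otherwise it is at most the left limit at \<open>s\<close> of the Wronskian of an
inner pair \<open>(d, e)\<close>, and shortly before \<open>s\<close> fewer singular times have been passed, so that the
induction hypothesis applies. The pair must be arbitrary in the induction.\<close>
lemma wronskian_le:
  assumes f: "\<And>t. (f has_real_derivative f' t) (at t)" "\<And>t. (f' has_real_derivative c * f t) (at t)"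
    and f_nonneg: "\<And>t. 0 \<le> t \<Longrightarrow> 0 \<le> f t"
    and B_init: "\<And>k l. \<lbrakk>k \<in> {1..N}; l \<in> {1..N}; x l \<le> x k\<rbrakk>
      \<Longrightarrow> (v k - v l) * f 0 - (x k - x l) * f' 0 \<le> B k l"
    and B_nonneg: "\<And>k l. \<lbrakk>k \<in> {1..N}; l \<in> {1..N}; x l \<le> x k\<rbrakk> \<Longrightarrow> 0 \<le> B k l"
    and B_mono: "\<And>k l d e. \<lbrakk>k \<in> {1..N}; l \<in> {1..N}; d \<in> {1..N}; e \<in> {1..N};
      x l \<le> x e; x e \<le> x d; x d \<le> x k\<rbrakk> \<Longrightarrow> B d e \<le> B k l"
    and kl: "k \<in> {1..N}" "l \<in> {1..N}" "x l \<le> x k" and t: "0 < t" "t \<notin> singular_times"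
  shows "wronskian f f' k l t \<le> B k l"
  using kl t
proof (induction "card (singular_times \<inter> {0<..<t})" arbitrary: k l t rule: less_induct)
  case (less t k l)
  note kl = less.prems(1-3)
  let ?S = "singular_times \<inter> {0<..<t}"
  have finS: "finite ?S" using finite_singular_times by simp
  obtain s where s: "0 \<le> s" "s < t" "{s<..t} \<inter> singular_times = {}" "s = 0 \<or> s \<in> ?S"
  proof (cases "?S = {}")
    case True
    then have "{0<..t} \<inter> singular_times = {}"
      using less.prems(5) by (auto simp: less_le)
    then show ?thesis using that[of 0] less.prems(4) by auto
  next
    case False
    have "Max ?S \<in> ?S" by (rule Max_in[OF finS False])
    moreover have "{Max ?S<..t} \<inter> singular_times = {}"
    proof (rule ccontr)
      assume "{Max ?S<..t} \<inter> singular_times \<noteq> {}"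
      then obtain r where r: "Max ?S < r" "r \<le> t" "r \<in> singular_times" by auto
      then have "r \<in> ?S"
        using less.prems(5) \<open>Max ?S \<in> ?S\<close> by (cases "r = t") auto
      then show False using Max_ge[OF finS, of r] r(1) by simp
    qed
    ultimately show ?thesis using that[of "Max ?S"] by auto
  qed
  have "wronskian f f' k l t
      \<le> (right_velocity (\<gamma> k) s - right_velocity (\<gamma> l) s) * f s - (\<gamma> k s - \<gamma> l s) * f' s"
  proof (rule tendsto_lowerbound[OF wronskian_at_right[OF kl(1,2) s(1) f]])
    show "\<forall>\<^sub>F r in at_right s. wronskian f f' k l t \<le> wronskian f f' k l r"
      unfolding eventually_at_right_field
    proof (intro exI[of _ t] conjI allI impI s(2))
      fix r assume r: "s < r" "r < t"
      have "{r..t} \<subseteq> {s<..t}" using r by auto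
      then show "wronskian f f' k l t \<le> wronskian f f' k l r"
        using s r by (intro wronskian_antimono[OF kl f f_nonneg]) auto
    qed
  qed auto
  also have "\<dots> \<le> B k l"
  proof (cases "s = 0")
    case True
    then show ?thesis
      using B_init[OF kl] kl by (simp add: right_velocity_0 initial_position)
  next
    case False
    then have s0: "0 < s" and sS: "s \<in> ?S" using s by auto
    show ?thesis
    proof (cases "\<gamma> k s = \<gamma> l s")
      case True
      then have "cluster k s = cluster l s" by (simp add: cluster_def)
      then have "right_velocity (\<gamma> k) s = right_velocity (\<gamma> l) s"
        using right_velocity_cluster[OF kl(1) s0] right_velocity_cluster[OF kl(2) s0] by simp
      then show ?thesis using True B_nonneg[OF kl] by simp
    next
      case apart: False
      obtain d where d: "d \<in> {1..N}" "\<gamma> d s = \<gamma> k s" "x d \<le> x k"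
        "right_velocity (\<gamma> k) s \<le> left_velocity (\<gamma> d) s"
        by (rule right_velocity_le_left_velocity[OF kl(1) s0])
      obtain e where e: "e \<in> {1..N}" "\<gamma> e s = \<gamma> l s" "x l \<le> x e"
        "left_velocity (\<gamma> e) s \<le> right_velocity (\<gamma> l) s"
        by (rule left_velocity_le_right_velocity[OF kl(2) s0])
      \<comment> \<open>The clusters of \<open>k\<close> and \<open>l\<close> are still apart at \<open>s\<close>, so their members are in the same order.\<close>
      have ed: "x e \<le> x d"
      proof (rule ccontr)
        assume "\<not> x e \<le> x d"
        then have "\<gamma> d s \<le> \<gamma> e s" using d e s0 by (intro order_preserved) auto
        then show False using order_preserved[OF kl s(1)] apart d(2) e(2) by simp
      qed
      have "(right_velocity (\<gamma> k) s - right_velocity (\<gamma> l) s) * f s - (\<gamma> k s - \<gamma> l s) * f' s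
          \<le> (left_velocity (\<gamma> d) s - left_velocity (\<gamma> e) s) * f s - (\<gamma> d s - \<gamma> e s) * f' s"
        using d(2,4) e(2,4) f_nonneg[OF s(1)] by (simp add: mult_right_mono)
      also have "\<dots> \<le> B d e"
      proof (rule tendsto_upperbound[OF wronskian_at_left[OF d(1) e(1) s0 f]])
        have "\<forall>\<^sub>F r in at_left s. 0 < r \<and> r < s"
          unfolding eventually_at_left_field by (rule exI[of _ 0]) (simp add: s0)
        moreover have "\<forall>\<^sub>F r in at_left s. r \<notin> singular_times"
          by (rule eventually_at_left_not_in_finite[OF finite_singular_times])
        moreover have "wronskian f f' d e r \<le> B d e" if r: "0 < r \<and> r < s" "r \<notin> singular_times" for r
        proof (rule less.hyps[OF _ d(1) e(1) ed])
          have "singular_times \<inter> {0<..<r} \<subseteq> ?S" "s \<in> ?S" "s \<notin> singular_times \<inter> {0<..<r}"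
            using sS r(1) by auto
          then have "singular_times \<inter> {0<..<r} \<subset> ?S" by blast
          then show "card (singular_times \<inter> {0<..<r}) < card ?S"
            by (rule psubset_card_mono[OF finS])
        qed (use r in auto)
        ultimately show "\<forall>\<^sub>F r in at_left s. wronskian f f' d e r \<le> B d e"
          by (rule eventually_elim2)
      qed auto
      also have "\<dots> \<le> B k l"
        by (rule B_mono[OF kl(1,2) d(1) e(1) e(3) ed d(3)])
      finally show ?thesis .
    qed
  qed
  finally show ?case .
qed

text \<open>The derivative of \<open>y / f\<close> is the Wronskian divided by \<open>f\<^sup>2\<close>, and \<open>H\<close> is a primitive of the
resulting bound \<open>b / f\<^sup>2\<close>.\<close>
lemma separation_quotient_comparison:
  assumes f: "\<And>t. (f has_real_derivative f' t) (at t)"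
    and kl: "k \<in> {1..N}" "l \<in> {1..N}"
    and wronskian: "\<And>t. \<lbrakk>0 < t; t \<notin> singular_times\<rbrakk> \<Longrightarrow> wronskian f f' k l t \<le> b"
    and f_pos: "\<And>r. r \<in> {s..t} \<Longrightarrow> 0 < f r"
    and H: "\<And>r. r \<in> {s..t} \<Longrightarrow> (H has_real_derivative b / (f r)\<^sup>2) (at r)"
    and st: "0 \<le> s" "s \<le> t"
  shows "(\<gamma> k t - \<gamma> l t) / f t - H t \<le> (\<gamma> k s - \<gamma> l s) / f s - H s"
proof (rule nonincreasing_off_finite[OF finite_singular_times st(2)])
  have "continuous_on {s..t} f" "continuous_on {s..t} H"
    using f H by (meson DERIV_isCont continuous_at_imp_continuous_on)+
  then show "continuous_on {s..t} (\<lambda>r. (\<gamma> k r - \<gamma> l r) / f r - H r)"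
    using kl f_pos st
    by (intro continuous_intros) (auto intro: continuous_on_subset[OF continuous_path] simp: less_imp_neq[symmetric])
next
  fix r assume r: "r \<in> {s<..<t} - singular_times"
  then have reg: "0 < r" "r \<notin> singular_times" using st by auto
  have fr: "f r > 0" using f_pos r by auto
  have "((\<lambda>r. (\<gamma> k r - \<gamma> l r) / f r - H r) has_real_derivative
      ((deriv (\<gamma> k) r - deriv (\<gamma> l) r) * f r - (\<gamma> k r - \<gamma> l r) * f' r) / (f r * f r)
        - b / (f r)\<^sup>2) (at r)"
    using r fr by (intro DERIV_diff DERIV_divide regular_time(1)[OF kl(1) reg]
        regular_time(1)[OF kl(2) reg] f H) auto
  then show "((\<lambda>r. (\<gamma> k r - \<gamma> l r) / f r - H r) has_real_derivative
      (wronskian f f' k l r - b) / (f r)\<^sup>2) (at r)"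
    by (simp add: wronskian_def power2_eq_square diff_divide_distrib)
  show "(wronskian f f' k l r - b) / (f r)\<^sup>2 \<le> 0"
    using wronskian[OF reg] by (simp add: divide_nonpos_nonneg)
qed

text \<open>For \<open>f = sinh (q t)\<close> the Wronskian starts at \<open>- q (x k - x l) \<le> 0\<close>, since \<open>f 0 = 0\<close> removes the
initial velocities.\<close>
lemma separation_over_sinh_nonincreasing:
  assumes "0 < c" and kl: "k \<in> {1..N}" "l \<in> {1..N}" "x l \<le> x k" and st: "0 < s" "s \<le> t"
  shows "(\<gamma> k t - \<gamma> l t) / sinh (sqrt c * t) \<le> (\<gamma> k s - \<gamma> l s) / sinh (sqrt c * s)"
proof -
  define q where "q = sqrt c"
  have q: "0 < q" "c = q * q" using \<open>0 < c\<close> by (auto simp: q_def)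
  let ?f = "\<lambda>t. sinh (q * t)" and ?f' = "\<lambda>t. q * cosh (q * t)"
  have f: "(?f has_real_derivative ?f' r) (at r)" "(?f' has_real_derivative c * ?f r) (at r)" for r
    by (auto intro!: derivative_eq_intros simp: q(2))
  have "wronskian ?f ?f' k l r \<le> 0" if "0 < r" "r \<notin> singular_times" for r
    by (rule wronskian_le[OF f, where B = "\<lambda>_ _. 0"]) (use that kl q in auto)
  then have "(\<gamma> k t - \<gamma> l t) / sinh (q * t) - 0 \<le> (\<gamma> k s - \<gamma> l s) / sinh (q * s) - 0"
    using kl st q by (intro separation_quotient_comparison[OF f(1), where b = 0 and H = "\<lambda>_. 0"]) auto
  then show ?thesis by (simp add: q_def)
qed

text \<open>For \<open>f = cosh (q t)\<close> the Wronskian starts at \<open>v k - v l\<close>, since \<open>f' 0 = 0\<close>, and \<open>1 / f\<^sup>2\<close> has the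
primitive \<open>sinh (q t) / (q cosh (q t))\<close>.\<close>
lemma separation_le_cosh_sinh:
  assumes "0 < c"
    and B_init: "\<And>k l. \<lbrakk>k \<in> {1..N}; l \<in> {1..N}; x l \<le> x k\<rbrakk> \<Longrightarrow> v k - v l \<le> B k l"
    and B_nonneg: "\<And>k l. \<lbrakk>k \<in> {1..N}; l \<in> {1..N}; x l \<le> x k\<rbrakk> \<Longrightarrow> 0 \<le> B k l"
    and B_mono: "\<And>k l d e. \<lbrakk>k \<in> {1..N}; l \<in> {1..N}; d \<in> {1..N}; e \<in> {1..N};
      x l \<le> x e; x e \<le> x d; x d \<le> x k\<rbrakk> \<Longrightarrow> B d e \<le> B k l"
    and kl: "k \<in> {1..N}" "l \<in> {1..N}" "x l \<le> x k" and "0 \<le> t"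
  shows "\<gamma> k t - \<gamma> l t
    \<le> cosh (sqrt c * t) * (x k - x l) + 1 / sqrt c * sinh (sqrt c * t) * B k l"
proof -
  define q where "q = sqrt c"
  have q: "0 < q" "c = q * q" using \<open>0 < c\<close> by (auto simp: q_def)
  let ?f = "\<lambda>t. cosh (q * t)" and ?f' = "\<lambda>t. q * sinh (q * t)"
  let ?H = "\<lambda>t. B k l * (sinh (q * t) / (q * cosh (q * t)))"
  have f: "(?f has_real_derivative ?f' r) (at r)" "(?f' has_real_derivative c * ?f r) (at r)" for r
    by (auto intro!: derivative_eq_intros simp: q(2))
  have H: "(?H has_real_derivative B k l / (cosh (q * r))\<^sup>2) (at r)" for r
  proof -
    have "((\<lambda>t. sinh (q * t) / (q * cosh (q * t))) has_real_derivative
        ((q * cosh (q * r)) * (q * cosh (q * r)) - sinh (q * r) * (q * (q * sinh (q * r))))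
          / ((q * cosh (q * r)) * (q * cosh (q * r)))) (at r)"
      using q(1) by (auto intro!: derivative_eq_intros)
    moreover have "(q * cosh (q * r)) * (q * cosh (q * r)) - sinh (q * r) * (q * (q * sinh (q * r))) = q * q"
      using cosh_square_eq[of "q * r"] by algebra
    ultimately have "((\<lambda>t. sinh (q * t) / (q * cosh (q * t))) has_real_derivative
        1 / (cosh (q * r))\<^sup>2) (at r)"
      using q(1) by (simp add: power2_eq_square)
    from DERIV_cmult[OF this, of "B k l"] show ?thesis by simp
  qed
  have "wronskian ?f ?f' k l r \<le> B k l" if "0 < r" "r \<notin> singular_times" for r
    by (rule wronskian_le[OF f]) (use that kl B_init B_nonneg B_mono in auto)
  then have "(\<gamma> k t - \<gamma> l t) / cosh (q * t) - ?H t \<le> (\<gamma> k 0 - \<gamma> l 0) / cosh (q * 0) - ?H 0"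
    using kl \<open>0 \<le> t\<close> H by (intro separation_quotient_comparison[OF f(1), where b = "B k l"]) auto
  then have "(\<gamma> k t - \<gamma> l t) / cosh (q * t) \<le> (x k - x l) + ?H t"
    using kl by (simp add: initial_position)
  then have "\<gamma> k t - \<gamma> l t \<le> ((x k - x l) + ?H t) * cosh (q * t)"
    by (simp add: pos_divide_le_eq)
  also have "\<dots> = cosh (q * t) * (x k - x l) + 1 / q * sinh (q * t) * B k l"
    using q(1) by (simp add: field_simps)
  finally show ?thesis by (simp add: q_def)
qed

end

section \<open>Contraction estimates for sticky particles\<close>

text \<open>Add the two tangent inequalities of the convex function at \<open>p\<close> and at \<open>q\<close>.\<close>
lemma semiconvex_slope_bound:
  fixes W W' :: "real \<Rightarrow> real"
  assumes W': "\<And>p. (W has_real_derivative W' p) (at p)"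
    and convex: "convex_on UNIV (\<lambda>y. W y + c / 2 * y\<^sup>2)" and "q \<le> p"
  shows "W' q + c * q \<le> W' p + c * p"
proof (cases "q = p")
  case False
  let ?h = "\<lambda>y. W y + c / 2 * y\<^sup>2" and ?h' = "\<lambda>y. W' y + c * y"
  have "(?h has_real_derivative ?h' r) (at r)" for r
    by (auto intro!: derivative_eq_intros W')
  then have tangent: "?h' r * (s - r) \<le> ?h s - ?h r" for r s
    by (intro convex_on_imp_above_tangent[OF convex]) auto
  have "(?h' p - ?h' q) * (p - q) \<ge> 0"
    using tangent[of q p] tangent[of p q] by (simp add: algebra_simps)
  then show ?thesis
    using False \<open>q \<le> p\<close> by (simp add: zero_le_mult_iff)
qed simp

theorem proposition2p5:
  fixes W v\<^sub>0 :: "real \<Rightarrow> real" and c :: real and N :: nat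
    and m x :: "nat \<Rightarrow> real" and \<gamma> :: "nat \<Rightarrow> real \<Rightarrow> real" and i j :: nat
  assumes "W C1_differentiable_on UNIV"
    and "\<forall>y. W (- y) = W y"
    and "c > 0"
    and "convex_on UNIV (\<lambda>y. W y + c / 2 * y\<^sup>2)"
    and "absolutely_continuous_fun v\<^sub>0"
    and "\<forall>k\<in>{1..N}. m k > 0"
    and "(\<Sum>k=1..N. m k) = 1"
    and "sticky_particle_trajectories W N m x (\<lambda>k. v\<^sub>0 (x k)) \<gamma>"
    and "i \<in> {1..N}" and "j \<in> {1..N}"
  shows "(\<forall>s t. 0 < s \<and> s \<le> t \<longrightarrow>
            \<bar>\<gamma> i t - \<gamma> j t\<bar> / sinh (sqrt c * t) \<le> \<bar>\<gamma> i s - \<gamma> j s\<bar> / sinh (sqrt c * s)) \<and>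
         (x i \<ge> x j \<longrightarrow>
            (\<forall>t\<ge>0. 0 \<le> \<gamma> i t - \<gamma> j t \<and>
               \<gamma> i t - \<gamma> j t \<le> cosh (sqrt c * t) * (x i - x j)
                 + 1 / sqrt c * sinh (sqrt c * t) * (LINT y:{x j..x i}|lebesgue. \<bar>deriv v\<^sub>0 y\<bar>)))"
proof -
  have W': "(W has_real_derivative deriv W p) (at p)" for p
  proof -
    obtain D where "(W has_real_derivative D) (at p)"
      using assms(1) unfolding C1_differentiable_on_def has_real_derivative_iff_has_vector_derivative
      by blast
    then show ?thesis by (simp add: DERIV_imp_deriv)
  qed
  interpret sticky_particles W c N m x "\<lambda>k. v\<^sub>0 (x k)" \<gamma>
    using assms(6-8) semiconvex_slope_bound[OF W' assms(4)] by unfold_locales auto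
  have ratio: "\<bar>\<gamma> k t - \<gamma> l t\<bar> / sinh (sqrt c * t) \<le> \<bar>\<gamma> k s - \<gamma> l s\<bar> / sinh (sqrt c * s)"
    if "k \<in> {1..N}" "l \<in> {1..N}" "x l \<le> x k" "0 < s" "s \<le> t" for k l s t
    using separation_over_sinh_nonincreasing[OF assms(3) that] order_preserved[OF that(1-3)] that
    by simp
  show ?thesis
  proof (intro conjI allI impI)
    fix s t :: real assume "0 < s \<and> s \<le> t"
    then show "\<bar>\<gamma> i t - \<gamma> j t\<bar> / sinh (sqrt c * t) \<le> \<bar>\<gamma> i s - \<gamma> j s\<bar> / sinh (sqrt c * s)"
      using ratio[of i j s t] ratio[of j i s t] assms(9,10)
      by (cases "x j \<le> x i") (auto simp: abs_minus_commute)
  next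
    fix t :: real assume "x j \<le> x i" "0 \<le> t"
    then show "0 \<le> \<gamma> i t - \<gamma> j t"
      using order_preserved assms(9,10) by simp
    show "\<gamma> i t - \<gamma> j t \<le> cosh (sqrt c * t) * (x i - x j)
        + 1 / sqrt c * sinh (sqrt c * t) * (LINT y:{x j..x i}|lebesgue. \<bar>deriv v\<^sub>0 y\<bar>)"
    proof (rule separation_le_cosh_sinh[where B = "\<lambda>k l. LINT y:{x l..x k}|lebesgue. \<bar>deriv v\<^sub>0 y\<bar>"])
      fix k l assume "x l \<le> x k"
      then show "v\<^sub>0 (x k) - v\<^sub>0 (x l) \<le> (LINT y:{x l..x k}|lebesgue. \<bar>deriv v\<^sub>0 y\<bar>)"
        by (rule absolutely_continuous_fun_increment_le[OF assms(5)])
      show "0 \<le> (LINT y:{x l..x k}|lebesgue. \<bar>deriv v\<^sub>0 y\<bar>)"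
        by (simp add: set_lebesgue_integral_def)
    next
      fix k l d e assume "x l \<le> x e" "x e \<le> x d" "x d \<le> x k"
      then show "(LINT y:{x e..x d}|lebesgue. \<bar>deriv v\<^sub>0 y\<bar>) \<le> (LINT y:{x l..x k}|lebesgue. \<bar>deriv v\<^sub>0 y\<bar>)"
        by (rule integral_abs_deriv_mono[OF assms(5)])
    qed (use assms \<open>x j \<le> x i\<close> \<open>0 \<le> t\<close> in auto)
  qed
qed

end
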